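(* Let $G$ be a complex Lie group and let $F$ be a left invariant complex Finsler metric on $G$. Then the following three properties of $F$ are equivalent: $F$ is strongly Kähler; $F$ is Kähler; $F$ is weakly Kähler. Moreover, $F$ is Kähler if and only if the Lie algebra of $G$ is Abelian.
   Context: Conventions: repeated indices are summed. $M$ is a complex manifold of complex dimension $n>0$; for a holomorphic local coordinate $z=(z^1,\dots,z^n)$ on $M$, $(z,w)=(z^1,\dots,z^n,w^1,\dots,w^n)$ denotes the induced holomorphic coordinate on the holomorphic tangent bundle $T^{1,0}M$, representing $w^i\partial_{z^i}\in T^{1,0}_zM$. $T^{1,0}M\setminus 0$ is the complement of the zero section. A complex Finsler metric on $M$ is a continuous function $F:T^{1,0}M\to[0,+\infty)$ such that: (1) $F$ is positive and smooth on $T^{1,0}M\setminus 0$; (2) $F(z,\lambda w)=|\lambda|F(z,w)$ for all $(z,w)\in T^{1,0}M$, $\lambda\in\mathbb{C}$; (3) (pseudo-convexity) with $\mathrm{G}=F^2$, the complex Hessian $(\mathrm{G}_{i\overline{j}})=(\partial_{w^i}\partial_{\overline{w}^j}\mathrm{G})$ is positive definite at every point of $T^{1,0}M\setminus 0$. Write $\mathrm{G}_i=\partial_{w^i}\mathrm{G}$, and let $(\mathrm{G}^{\overline{i}j})$ be the inverse matrix: $\mathrm{G}_{k\overline{j}}\mathrm{G}^{\overline{j}i}=\delta^i_k$. On $T^{1,0}M\setminus0$ put $N^i_k=\mathrm{G}^{\overline{j}i}\,\partial_{\overline{w}^j}\partial_{z^k}\mathrm{G}$ and $\Gamma^i_{j;k}=\partial_{w^j}N^i_k$.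 The metric $F$ is called - strongly Kähler if $\Gamma^i_{j;k}-\Gamma^i_{k;j}=0$ for all $i,j,k$, - Kähler if $w^k(\Gamma^i_{j;k}-\Gamma^i_{k;j})=0$ for all $i,j$, - weakly Kähler if $w^k(\Gamma^i_{j;k}-\Gamma^i_{k;j})\mathrm{G}_i=0$ for all $j$, in each case everywhere on $T^{1,0}M\setminus 0$ (in every holomorphic local chart). A complex Lie group is a complex manifold with a group structure whose multiplication and inversion are holomorphic. A complex Finsler metric $F$ on $G$ is left invariant if $F((L_g)_*w)=F(w)$ for all $g\in G$ and $w\in T^{1,0}G$, where $L_g(g')=gg'$. *)

theory Defs
  imports "HOL-Analysis.Analysis" "HOL-Algebra.Group"
begin

section \<open>Smooth and holomorphic maps on open sets\<close>

text \<open>The sets S below are always open, so derivatives are taken with the filter \<open>at x\<close>.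
  \<open>Ck_on k\<close> is real k-fold continuous differentiability.\<close>

primrec Ck_on :: "nat \<Rightarrow> 'e::real_normed_vector set \<Rightarrow> ('e \<Rightarrow> 'f::real_normed_vector) \<Rightarrow> bool" where
  "Ck_on 0 S f \<longleftrightarrow> continuous_on S f"
| "Ck_on (Suc k) S f \<longleftrightarrow> (\<forall>x\<in>S. f differentiable (at x)) \<and>
     (\<forall>v. Ck_on k S (\<lambda>x. frechet_derivative f (at x) v))"

definition smooth_on :: "'e::real_normed_vector set \<Rightarrow> ('e \<Rightarrow> 'f::real_normed_vector) \<Rightarrow> bool" where
  "smooth_on S f \<longleftrightarrow> (\<forall>k. Ck_on k S f)"

text \<open>Complex differentiability between real normed spaces carrying complex scalar
  multiplications s and t: the real derivative exists and is complex linear.\<close>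

definition holo_on :: "(complex \<Rightarrow> 'e::real_normed_vector \<Rightarrow> 'e) \<Rightarrow>
    (complex \<Rightarrow> 'f::real_normed_vector \<Rightarrow> 'f) \<Rightarrow> 'e set \<Rightarrow> ('e \<Rightarrow> 'f) \<Rightarrow> bool" where
  "holo_on s t S f \<longleftrightarrow>
     (\<forall>x\<in>S. \<exists>D. (f has_derivative D) (at x) \<and> (\<forall>a v. D (s a v) = t a (D v)))"

definition pair_scale :: "complex \<Rightarrow> (complex^'n) \<times> (complex^'n) \<Rightarrow> (complex^'n) \<times> (complex^'n)" where
  "pair_scale a = (\<lambda>(v, w). (a *s v, a *s w))"

section \<open>Complex manifolds\<close>

type_synonym ('a, 'n) chart = "'a set \<times> ('a \<Rightarrow> complex^'n)"

text \<open>The values of the coordinate map outside the chart domain are irrelevant.\<close>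

abbreviation dom_of :: "('a, 'n) chart \<Rightarrow> 'a set" where "dom_of c \<equiv> fst c"
abbreviation coord :: "('a, 'n) chart \<Rightarrow> 'a \<Rightarrow> complex^'n" where "coord c \<equiv> snd c"
abbreviation img :: "('a, 'n) chart \<Rightarrow> (complex^'n) set" where "img c \<equiv> coord c ` dom_of c"
abbreviation param :: "('a, 'n) chart \<Rightarrow> complex^'n \<Rightarrow> 'a" where
  "param c \<equiv> inv_into (dom_of c) (coord c)"

definition is_chart :: "'a topology \<Rightarrow> ('a, 'n::finite) chart \<Rightarrow> bool" where
  "is_chart X c \<longleftrightarrow> openin X (dom_of c) \<and> open (img c) \<and>
     homeomorphic_map (subtopology X (dom_of c)) (subtopology euclidean (img c)) (coord c)"

definition compatible :: "('a, 'n::finite) chart \<Rightarrow> ('a, 'n) chart \<Rightarrow> bool" where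
  "compatible c d \<longleftrightarrow>
     holo_on (*s) (*s) (coord c ` (dom_of c \<inter> dom_of d)) (coord d \<circ> param c) \<and>
     holo_on (*s) (*s) (coord d ` (dom_of c \<inter> dom_of d)) (coord c \<circ> param d)"

text \<open>The atlas A is maximal, i.e. it consists of all holomorphic charts of the manifold.
  The complex dimension \<open>CARD('n)\<close> is automatically positive.\<close>

definition complex_manifold :: "'a topology \<Rightarrow> ('a, 'n::finite) chart set \<Rightarrow> bool" where
  "complex_manifold X A \<longleftrightarrow>
     Hausdorff_space X \<and> second_countable X \<and>
     (\<forall>c\<in>A. is_chart X c) \<and> (\<Union>c\<in>A. dom_of c) = topspace X \<and>
     (\<forall>c\<in>A. \<forall>d\<in>A. compatible c d) \<and>
     (\<forall>c. is_chart X c \<and> (\<forall>d\<in>A. compatible c d) \<longrightarrow> c \<in> A)"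

definition holomorphic_map ::
    "'a topology \<Rightarrow> ('a, 'n::finite) chart set \<Rightarrow> 'b topology \<Rightarrow> ('b, 'm::finite) chart set \<Rightarrow>
     ('a \<Rightarrow> 'b) \<Rightarrow> bool" where
  "holomorphic_map X A Y B f \<longleftrightarrow> continuous_map X Y f \<and>
     (\<forall>c\<in>A. \<forall>d\<in>B. holo_on (*s) (*s)
        (coord c ` {p \<in> dom_of c. f p \<in> dom_of d}) (coord d \<circ> f \<circ> param c))"

text \<open>Holomorphy of a map from X \<open>\<times>\<close> X, read off in product charts.\<close>

definition holomorphic_map2 ::
    "'a topology \<Rightarrow> ('a, 'n::finite) chart set \<Rightarrow> ('a \<Rightarrow> 'a \<Rightarrow> 'a) \<Rightarrow> bool" where
  "holomorphic_map2 X A f \<longleftrightarrow> continuous_map (prod_topology X X) X (\<lambda>(p, q). f p q) \<and>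
     (\<forall>c\<in>A. \<forall>d\<in>A. \<forall>e\<in>A. holo_on pair_scale (*s)
        {(y, z). y \<in> img c \<and> z \<in> img d \<and> f (param c y) (param d z) \<in> dom_of e}
        (\<lambda>(y, z). coord e (f (param c y) (param d z))))"

section \<open>The holomorphic tangent bundle\<close>

definition holo_near :: "'a topology \<Rightarrow> ('a, 'n::finite) chart set \<Rightarrow> 'a \<Rightarrow> ('a \<Rightarrow> complex) \<Rightarrow> bool" where
  "holo_near X A p h \<longleftrightarrow> (\<exists>U. openin X U \<and> p \<in> U \<and>
     (\<forall>c\<in>A. holo_on (*s) (*) (coord c ` (dom_of c \<inter> U)) (h \<circ> param c)))"

text \<open>Tangent vectors at p are first order operators on functions that are holomorphic near p,
  extended by 0 to all other functions. \<open>tvec X A c p w\<close> is \<open>w\<^sup>i \<partial>/\<partial>z\<^sup>i\<close> at p,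
  in the coordinate \<open>z = coord c\<close>.\<close>

type_synonym 'a tangent = "('a \<Rightarrow> complex) \<Rightarrow> complex"

definition tvec :: "'a topology \<Rightarrow> ('a, 'n::finite) chart set \<Rightarrow> ('a, 'n) chart \<Rightarrow> 'a \<Rightarrow>
    complex^'n \<Rightarrow> 'a tangent" where
  "tvec X A c p w = (\<lambda>h. if holo_near X A p h
     then (\<Sum>i\<in>UNIV. w $ i * frechet_derivative (h \<circ> param c) (at (coord c p)) (axis i 1))
     else 0)"

definition tangent_space :: "'a topology \<Rightarrow> ('a, 'n::finite) chart set \<Rightarrow> 'a \<Rightarrow> 'a tangent set" where
  "tangent_space X A p = {tvec X A c p w | c w. c \<in> A \<and> p \<in> dom_of c}"

definition tangent_bundle :: "'a topology \<Rightarrow> ('a, 'n::finite) chart set \<Rightarrow> ('a \<times> 'a tangent) set" where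
  "tangent_bundle X A = Sigma (topspace X) (tangent_space X A)"

definition pushforward :: "('a \<Rightarrow> 'a) \<Rightarrow> 'a tangent \<Rightarrow> 'a tangent" where
  "pushforward f v = (\<lambda>h. v (h \<circ> f))"

section \<open>Complex Finsler metrics\<close>

text \<open>The coordinate expression F(z,w) in the chart of the tangent bundle induced by c. Its domain
  is \<open>img c \<times> UNIV\<close>. Continuity and smoothness on the bundle refer to these induced charts.\<close>

definition local_rep :: "'a topology \<Rightarrow> ('a, 'n::finite) chart set \<Rightarrow> ('a \<times> 'a tangent \<Rightarrow> real) \<Rightarrow>
    ('a, 'n) chart \<Rightarrow> (complex^'n) \<times> (complex^'n) \<Rightarrow> real" where
  "local_rep X A F c = (\<lambda>(z, w). F (param c z, tvec X A c (param c z) w))"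

definition local_G :: "'a topology \<Rightarrow> ('a, 'n::finite) chart set \<Rightarrow> ('a \<times> 'a tangent \<Rightarrow> real) \<Rightarrow>
    ('a, 'n) chart \<Rightarrow> (complex^'n) \<times> (complex^'n) \<Rightarrow> complex" where
  "local_G X A F c = (\<lambda>u. complex_of_real ((local_rep X A F c u)\<^sup>2))"

text \<open>Wirtinger derivatives \<open>\<partial>/\<partial>z\<^sup>k\<close>, \<open>\<partial>/\<partial>w\<^sup>k\<close> and \<open>\<partial>/\<partial>\<close>(conjugate of \<open>w\<^sup>k\<close>).\<close>

definition d_z :: "'n::finite \<Rightarrow> ((complex^'n) \<times> (complex^'n) \<Rightarrow> complex) \<Rightarrow>
    (complex^'n) \<times> (complex^'n) \<Rightarrow> complex" where
  "d_z k f u = (frechet_derivative f (at u) (axis k 1, 0)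
                - \<i> * frechet_derivative f (at u) (axis k \<i>, 0)) / 2"

definition d_w :: "'n::finite \<Rightarrow> ((complex^'n) \<times> (complex^'n) \<Rightarrow> complex) \<Rightarrow>
    (complex^'n) \<times> (complex^'n) \<Rightarrow> complex" where
  "d_w k f u = (frechet_derivative f (at u) (0, axis k 1)
                - \<i> * frechet_derivative f (at u) (0, axis k \<i>)) / 2"

definition d_wbar :: "'n::finite \<Rightarrow> ((complex^'n) \<times> (complex^'n) \<Rightarrow> complex) \<Rightarrow>
    (complex^'n) \<times> (complex^'n) \<Rightarrow> complex" where
  "d_wbar k f u = (frechet_derivative f (at u) (0, axis k 1)
                + \<i> * frechet_derivative f (at u) (0, axis k \<i>)) / 2"

definition hessian :: "((complex^'n::finite) \<times> (complex^'n) \<Rightarrow> complex) \<Rightarrow>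
    (complex^'n) \<times> (complex^'n) \<Rightarrow> complex^'n^'n" where
  "hessian f u = (\<chi> i j. d_w i (d_wbar j f) u)"

definition hermitian_pos_def :: "complex^'n::finite^'n \<Rightarrow> bool" where
  "hermitian_pos_def H \<longleftrightarrow> (\<forall>i j. H $ i $ j = cnj (H $ j $ i)) \<and>
     (\<forall>v. v \<noteq> 0 \<longrightarrow> 0 < Re (\<Sum>i\<in>UNIV. \<Sum>j\<in>UNIV. H $ i $ j * v $ i * cnj (v $ j)))"

definition complex_finsler_metric ::
    "'a topology \<Rightarrow> ('a, 'n::finite) chart set \<Rightarrow> ('a \<times> 'a tangent \<Rightarrow> real) \<Rightarrow> bool" where
  "complex_finsler_metric X A F \<longleftrightarrow>
     (\<forall>u\<in>tangent_bundle X A. 0 \<le> F u) \<and>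
     (\<forall>c\<in>A. continuous_on (img c \<times> UNIV) (local_rep X A F c)) \<and>
     (\<forall>(p, v)\<in>tangent_bundle X A. v \<noteq> (\<lambda>h. 0) \<longrightarrow> 0 < F (p, v)) \<and>
     (\<forall>c\<in>A. smooth_on (img c \<times> (UNIV - {0})) (local_rep X A F c)) \<and>
     (\<forall>(p, v)\<in>tangent_bundle X A. \<forall>a. F (p, \<lambda>h. a * v h) = cmod a * F (p, v)) \<and>
     (\<forall>c\<in>A. \<forall>u\<in>img c \<times> (UNIV - {0}). hermitian_pos_def (hessian (local_G X A F c) u))"

section \<open>Kaehler conditions\<close>

text \<open>With \<open>H\<close> the Hessian, the entry (j,i) of \<open>matrix_inv H\<close> is the coefficient of the inverse
  with upper indices (conjugate j, i). \<open>Nconn f i k\<close> is \<open>N\<^sup>i\<^sub>k\<close>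
  and \<open>Gam f i j k\<close> is \<open>\<Gamma>\<^sup>i\<close> with lower indices j;k, both computed from f = G.\<close>

definition Nconn :: "((complex^'n::finite) \<times> (complex^'n) \<Rightarrow> complex) \<Rightarrow> 'n \<Rightarrow> 'n \<Rightarrow>
    (complex^'n) \<times> (complex^'n) \<Rightarrow> complex" where
  "Nconn f i k = (\<lambda>u. \<Sum>j\<in>UNIV. matrix_inv (hessian f u) $ j $ i * d_wbar j (d_z k f) u)"

definition Gam :: "((complex^'n::finite) \<times> (complex^'n) \<Rightarrow> complex) \<Rightarrow> 'n \<Rightarrow> 'n \<Rightarrow> 'n \<Rightarrow>
    (complex^'n) \<times> (complex^'n) \<Rightarrow> complex" where
  "Gam f i j k = d_w j (Nconn f i k)"

definition strongly_kaehler ::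
    "'a topology \<Rightarrow> ('a, 'n::finite) chart set \<Rightarrow> ('a \<times> 'a tangent \<Rightarrow> real) \<Rightarrow> bool" where
  "strongly_kaehler X A F \<longleftrightarrow>
     (\<forall>c\<in>A. \<forall>z\<in>img c. \<forall>w. w \<noteq> 0 \<longrightarrow> (\<forall>i j k.
        Gam (local_G X A F c) i j k (z, w) - Gam (local_G X A F c) i k j (z, w) = 0))"

definition kaehler ::
    "'a topology \<Rightarrow> ('a, 'n::finite) chart set \<Rightarrow> ('a \<times> 'a tangent \<Rightarrow> real) \<Rightarrow> bool" where
  "kaehler X A F \<longleftrightarrow>
     (\<forall>c\<in>A. \<forall>z\<in>img c. \<forall>w. w \<noteq> 0 \<longrightarrow> (\<forall>i j.
        (\<Sum>k\<in>UNIV. w $ k *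
          (Gam (local_G X A F c) i j k (z, w) - Gam (local_G X A F c) i k j (z, w))) = 0))"

definition weakly_kaehler ::
    "'a topology \<Rightarrow> ('a, 'n::finite) chart set \<Rightarrow> ('a \<times> 'a tangent \<Rightarrow> real) \<Rightarrow> bool" where
  "weakly_kaehler X A F \<longleftrightarrow>
     (\<forall>c\<in>A. \<forall>z\<in>img c. \<forall>w. w \<noteq> 0 \<longrightarrow> (\<forall>j.
        (\<Sum>i\<in>UNIV. \<Sum>k\<in>UNIV. w $ k *
          (Gam (local_G X A F c) i j k (z, w) - Gam (local_G X A F c) i k j (z, w)) *
          d_w i (local_G X A F c) (z, w)) = 0))"

section \<open>Complex Lie groups\<close>

definition complex_lie_group ::
    "('a, 'b) monoid_scheme \<Rightarrow> 'a topology \<Rightarrow> ('a, 'n::finite) chart set \<Rightarrow> bool" where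
  "complex_lie_group G X A \<longleftrightarrow>
     group G \<and> complex_manifold X A \<and> topspace X = carrier G \<and>
     holomorphic_map2 X A (\<lambda>p q. p \<otimes>\<^bsub>G\<^esub> q) \<and>
     holomorphic_map X A X A (\<lambda>p. inv\<^bsub>G\<^esub> p)"

definition left_invariant_metric ::
    "('a, 'b) monoid_scheme \<Rightarrow> 'a topology \<Rightarrow> ('a, 'n::finite) chart set \<Rightarrow>
     ('a \<times> 'a tangent \<Rightarrow> real) \<Rightarrow> bool" where
  "left_invariant_metric G X A F \<longleftrightarrow>
     (\<forall>g\<in>carrier G. \<forall>(p, v)\<in>tangent_bundle X A.
        F (g \<otimes>\<^bsub>G\<^esub> p, pushforward (\<lambda>q. g \<otimes>\<^bsub>G\<^esub> q) v) = F (p, v))"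

definition holomorphic_vector_field ::
    "'a topology \<Rightarrow> ('a, 'n::finite) chart set \<Rightarrow> ('a \<Rightarrow> 'a tangent) \<Rightarrow> bool" where
  "holomorphic_vector_field X A V \<longleftrightarrow>
     (\<forall>c\<in>A. \<exists>w. holo_on (*s) (*s) (img c) w \<and>
        (\<forall>p\<in>dom_of c. V p = tvec X A c p (w (coord c p)))) \<and>
     (\<forall>p. p \<notin> topspace X \<longrightarrow> V p = (\<lambda>h. 0))"

text \<open>The guard makes the bracket at p again an operator that vanishes on functions which are
  not holomorphic near p, as is the case for all tangent vectors.\<close>

definition lie_bracket ::
    "'a topology \<Rightarrow> ('a, 'n::finite) chart set \<Rightarrow> ('a \<Rightarrow> 'a tangent) \<Rightarrow> ('a \<Rightarrow> 'a tangent) \<Rightarrow>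
     ('a \<Rightarrow> 'a tangent)" where
  "lie_bracket X A V W = (\<lambda>p h. if holo_near X A p h
     then V p (\<lambda>q. W q h) - W p (\<lambda>q. V q h) else 0)"

text \<open>The Lie algebra of a complex Lie group: the left invariant holomorphic vector fields with the
  commutator bracket.\<close>

definition lie_algebra ::
    "('a, 'b) monoid_scheme \<Rightarrow> 'a topology \<Rightarrow> ('a, 'n::finite) chart set \<Rightarrow> ('a \<Rightarrow> 'a tangent) set" where
  "lie_algebra G X A = {V. holomorphic_vector_field X A V \<and>
     (\<forall>g\<in>carrier G. \<forall>p\<in>carrier G.
        pushforward (\<lambda>q. g \<otimes>\<^bsub>G\<^esub> q) (V p) = V (g \<otimes>\<^bsub>G\<^esub> p))}"

definition abelian_lie_algebra ::
    "('a, 'b) monoid_scheme \<Rightarrow> 'a topology \<Rightarrow> ('a, 'n::finite) chart set \<Rightarrow> bool" where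
  "abelian_lie_algebra G X A \<longleftrightarrow>
     (\<forall>V\<in>lie_algebra G X A. \<forall>W\<in>lie_algebra G X A. lie_bracket X A V W = (\<lambda>p h. 0))"

end

theory Submission
  imports Defs "HOL-Complex_Analysis.Cauchy_Integral_Formula"
begin

text \<open>Left translations give a holomorphic frame \<open>E(z)\<close> of the tangent bundle along which G is
  constant: \<open>G(z, E(z) v)\<close> does not depend on z. Differentiating in z gives
  \<open>\<partial>G/\<partial>z\<^sup>k = G\<^sub>i (C\<^sub>k(z) w)\<^sup>i\<close> with \<open>C\<^sub>k = - (\<partial>\<^sub>k E) E\<^sup>-\<^sup>1\<close>, hence \<open>N\<^sup>i\<^sub>k = (C\<^sub>k(z) w)\<^sup>i\<close>,
  so that \<open>\<Gamma>\<^sup>i\<close> with lower indices j;k is the (i,j) entry of \<open>C\<^sub>k(z)\<close>, and its antisymmetric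
  part T depends on z only. If F is weakly Kaehler, i.e. \<open>T\<^sup>i\<^sub>j\<^sub>k w\<^sup>k G\<^sub>i = 0\<close>, then differentiation with
  respect to the conjugate of \<open>w\<^sup>l\<close> only hits \<open>G\<^sub>i\<close>, and nondegeneracy of the complex Hessian
  gives \<open>T\<^sup>i\<^sub>j\<^sub>k w\<^sup>k = 0\<close> for all w, so \<open>T = 0\<close>. In the frame E the tensor T is, up to sign, the bracket
  of left invariant vector fields.\<close>

section \<open>Derivatives of holomorphic functions of several variables\<close>

text \<open>\<open>holo_on\<close> supplies only pointwise complex differentiability, whereas the
  frame is itself a derivative: \<open>E(z)\<close> is the differential at the unit of left
  translation by the point with coordinate z, that is, a partial derivative of the group
  multiplication. To differentiate it once more, and to cancel the second derivatives in a bracket,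
  derivatives of holomorphic functions of several variables must again be holomorphic and must
  commute. Both come from Cauchy's formula on discs in complex lines: it writes a derivative as an
  integral of values of the function, and this integral can be differentiated under the integral
  sign.

  G is constant along the frame because \<open>E(z) v\<close> is the left translate of the vector v
  at the unit and F is left invariant. Derivatives in the conjugate of w pass over
  \<open>C\<^sub>k(z) w\<close> and over the contraction of T with w because both are complex linear
  in w; the first case yields the formula for N, the second one the step from weakly Kaehler to T =
  0.\<close>

definition circ :: "real \<Rightarrow> real \<Rightarrow> complex" where
  "circ r t = complex_of_real r * exp (2 * of_real pi * \<i> * of_real t)"

lemma circ_nz [simp]: "r > 0 \<Longrightarrow> circ r t \<noteq> 0" and norm_circ: "r > 0 \<Longrightarrow> cmod (circ r t) = r"
  by (auto simp: circ_def norm_mult)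

lemma continuous_on_circ [continuous_intros]:
  "continuous_on T u \<Longrightarrow> continuous_on T (\<lambda>x. circ r (u x))"
  unfolding circ_def by (intro continuous_intros)

text \<open>Cauchy's formula at the centre of the circle: the velocity of the path cancels the
  constant and one of the two powers in the denominator.\<close>

lemma deriv_circle_mean:
  assumes "r > 0" "continuous_on (cball 0 r) g" "g holomorphic_on ball 0 r"
  shows "deriv g 0 = integral {0..1} (\<lambda>t. g (circ r t) / circ r t)"
proof -
  have "2 * pi * \<i> * deriv g 0 = contour_integral (circlepath 0 r) (\<lambda>u. g u / u\<^sup>2)"
    using Cauchy_contour_integral_circlepath_2[of 0 r g 0] assms by simp
  also have "\<dots> = integral {0..1} (\<lambda>t. 2 * pi * \<i> * (g (circ r t) / circ r t))"
    unfolding contour_integral_integral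
  proof (rule Henstock_Kurzweil_Integration.integral_cong)
    fix t :: real
    have "circlepath 0 r t = circ r t"
      by (simp add: circlepath circ_def)
    moreover have "vector_derivative (circlepath 0 r) (at t) = 2 * pi * \<i> * circ r t"
      by (simp add: vector_derivative_circlepath circ_def)
    ultimately show "g (circlepath 0 r t) / (circlepath 0 r t)\<^sup>2 *
        vector_derivative (circlepath 0 r) (at t) = 2 * pi * \<i> * (g (circ r t) / circ r t)"
      using circ_nz[OF assms(1), of t] by (simp add: field_simps power2_eq_square)
  qed
  also have "\<dots> = 2 * pi * \<i> * integral {0..1} (\<lambda>t. g (circ r t) / circ r t)"
    by (rule integral_mult_right)
  finally show ?thesis by simp
qed

lemma holo_onD:
  assumes "holo_on s t S f" "x \<in> S"
  shows "(f has_derivative frechet_derivative f (at x)) (at x)"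
    and "frechet_derivative f (at x) (s a v) = t a (frechet_derivative f (at x) v)"
  using assms frechet_derivative_at unfolding holo_on_def by (metis, metis)

lemma holo_on_imp_continuous_on: "holo_on s t S f \<Longrightarrow> continuous_on S f"
  by (meson continuous_at_imp_continuous_on has_derivative_continuous holo_onD(1))

text \<open>The scaling is abstract because the theory is used for \<open>complex^'n\<close> and,
  through \<open>pair_scale\<close>, for the product space on which the group multiplication is read
  off.\<close>

locale complex_scaling = bounded_bilinear s
  for s :: "complex \<Rightarrow> 'e::euclidean_space \<Rightarrow> 'e"
begin

text \<open>On a complex line the problem has one variable: complex linearity turns the real
  derivative along the line into multiplication by a number.\<close>

lemma has_field_derivative_line:
  assumes "holo_on s (*) S h" "x + s \<zeta> v \<in> S"
  shows "((\<lambda>\<zeta>. h (x + s \<zeta> v)) has_field_derivative frechet_derivative h (at (x + s \<zeta> v)) v) (at \<zeta>)"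
proof -
  have "((\<lambda>\<zeta>. x + s \<zeta> v) has_derivative (\<lambda>a. s a v)) (at \<zeta>)"
    using has_derivative_add[OF has_derivative_const bounded_linear_imp_has_derivative[OF bounded_linear_left]]
    by simp
  then have "((\<lambda>\<zeta>. h (x + s \<zeta> v)) has_derivative
      (\<lambda>a. frechet_derivative h (at (x + s \<zeta> v)) (s a v))) (at \<zeta>)"
    by (rule has_derivative_compose[where g=h and f="\<lambda>\<zeta>. x + s \<zeta> v" and f'="\<lambda>a. s a v"
          and g'="frechet_derivative h (at (x + s \<zeta> v))"])
       (rule holo_onD(1)[OF assms])
  then show ?thesis
    unfolding has_field_derivative_def holo_onD(2)[OF assms]
    by (rule has_derivative_eq_rhs) (simp add: fun_eq_iff mult.commute)
qed

text \<open>The right side involves values of \<open>h\<close> only, so regularity of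
  \<open>h\<close> passes on to its derivative.\<close>

lemma frechet_derivative_circle_mean:
  assumes h: "holo_on s (*) S h" and "r > 0" and S: "\<And>\<zeta>. cmod \<zeta> \<le> r \<Longrightarrow> x + s \<zeta> v \<in> S"
  shows "frechet_derivative h (at x) v = integral {0..1} (\<lambda>t. h (x + s (circ r t) v) / circ r t)"
proof -
  have "deriv (\<lambda>\<zeta>. h (x + s \<zeta> v)) 0 = integral {0..1} (\<lambda>t. h (x + s (circ r t) v) / circ r t)"
  proof (rule deriv_circle_mean[OF \<open>r > 0\<close>])
    show "continuous_on (cball 0 r) (\<lambda>\<zeta>. h (x + s \<zeta> v))"
      by (rule DERIV_continuous_on, rule has_field_derivative_at_within,
          rule has_field_derivative_line[OF h S]) simp
    show "(\<lambda>\<zeta>. h (x + s \<zeta> v)) holomorphic_on ball 0 r"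
      unfolding holomorphic_on_def field_differentiable_def
    proof
      fix \<zeta> :: complex assume "\<zeta> \<in> ball 0 r"
      then have "x + s \<zeta> v \<in> S" by (intro S) simp
      from has_field_derivative_line[OF h this]
      show "\<exists>D. ((\<lambda>\<zeta>. h (x + s \<zeta> v)) has_field_derivative D) (at \<zeta> within ball 0 r)"
        by (blast intro: has_field_derivative_at_within)
    qed
  qed
  moreover have "deriv (\<lambda>\<zeta>. h (x + s \<zeta> v)) 0 = frechet_derivative h (at x) v"
    using DERIV_imp_deriv[OF has_field_derivative_line[OF h S, of 0]] \<open>r > 0\<close> by (simp add: zero_left)
  ultimately show ?thesis by simp
qed

text \<open>One radius has to serve all points near \<open>x\<close>; otherwise the circle mean
  would not represent the derivative on a neighbourhood.\<close>

lemma uniform_disc: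
  assumes "open S" "x \<in> S"
  obtains \<delta> r where "\<delta> > 0" "r > 0" "\<And>y \<zeta>. y \<in> ball x \<delta> \<Longrightarrow> cmod \<zeta> \<le> r \<Longrightarrow> y + s \<zeta> v \<in> S"
proof -
  obtain e where e: "e > 0" "ball x e \<subseteq> S"
    using assms open_contains_ball by blast
  obtain K where K: "K > 0" "\<And>a v. norm (s a v) \<le> norm a * norm v * K"
    using pos_bounded by blast
  \<comment> \<open>Half of \<open>e\<close> is left for the distance of \<open>y\<close> from
    \<open>x\<close>, half for the disc; the summand 1 covers \<open>v = 0\<close>.\<close>
  define r where "r = e / (2 * (K * (norm v + 1)))"
  have nz: "norm v + 1 > 0" by (simp add: add_nonneg_pos)
  then have r: "r > 0" "r * (norm v + 1) * K = e / 2"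
    using e(1) K(1) by (simp_all add: r_def)
  show thesis
  proof
    show "e / 2 > 0" "r > 0" using e r by auto
    fix y \<zeta> assume y: "y \<in> ball x (e/2)" "cmod \<zeta> \<le> r"
    have "norm (s \<zeta> v) \<le> r * norm v * K"
      by (rule order_trans[OF K(2)]) (use y K(1) in \<open>auto intro!: mult_right_mono\<close>)
    also have "\<dots> \<le> r * (norm v + 1) * K" using r(1) K(1) by (auto intro!: mult_right_mono mult_left_mono)
    finally have *: "norm (s \<zeta> v) \<le> e / 2" using r(2) by simp
    have "dist x (y + s \<zeta> v) \<le> dist x y + norm (s \<zeta> v)"
      by (metis add_diff_cancel_left' dist_commute dist_norm dist_triangle)
    then have "y + s \<zeta> v \<in> ball x e" using * y by simp
    then show "y + s \<zeta> v \<in> S" using e by blast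
  qed
qed

text \<open>The integrand of the circle mean is jointly continuous in the point and the angle. The
  result feeds the Leibniz rule below, which asks for a continuous derivative of the
  integrand.\<close>

lemma continuous_on_frechet_derivative:
  assumes "open S" "holo_on s (*) S h"
  shows "continuous_on S (\<lambda>x. frechet_derivative h (at x) v)"
proof (rule continuous_at_imp_continuous_on, rule ballI)
  fix x assume "x \<in> S"
  then obtain \<delta> r where d: "\<delta> > 0" "r > 0" "\<And>y \<zeta>. y \<in> ball x \<delta> \<Longrightarrow> cmod \<zeta> \<le> r \<Longrightarrow> y + s \<zeta> v \<in> S"
    using uniform_disc[OF \<open>open S\<close>] by metis
  have "continuous_on (ball x \<delta>) (\<lambda>y. integral (cbox 0 1) (\<lambda>t. h (y + s (circ r t) v) / circ r t))"
  proof (rule integral_continuous_on_param, unfold split_beta)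
    show "continuous_on (ball x \<delta> \<times> cbox 0 1) (\<lambda>p. h (fst p + s (circ r (snd p)) v) / circ r (snd p))"
      by (intro continuous_intros continuous_on_compose2[OF holo_on_imp_continuous_on[OF assms(2)]]
          continuous_on)
        (use d in \<open>auto simp: norm_circ\<close>)
  qed
  moreover have "frechet_derivative h (at y) v = integral (cbox 0 1) (\<lambda>t. h (y + s (circ r t) v) / circ r t)"
    if "y \<in> ball x \<delta>" for y
    using frechet_derivative_circle_mean[OF assms(2) d(2) d(3)[OF that]] by simp
  ultimately have "continuous_on (ball x \<delta>) (\<lambda>y. frechet_derivative h (at y) v)"
    using continuous_on_cong by (metis (no_types, lifting))
  then show "isCont (\<lambda>y. frechet_derivative h (at y) v) x"
    using d(1) by (simp add: continuous_on_eq_continuous_at)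
qed

text \<open>Differentiation of the circle mean under the integral sign. The radius and the explicit
  integral are exported because the symmetry of second derivatives is read off from them.\<close>

lemma has_derivative_frechet_derivative:
  assumes "open S" and h: "holo_on s (*) S h" and "x \<in> S"
  shows "\<exists>r>0. (\<forall>\<zeta>. cmod \<zeta> \<le> r \<longrightarrow> x + s \<zeta> v \<in> S) \<and>
    ((\<lambda>y. frechet_derivative h (at y) v) has_derivative
      (\<lambda>u. integral {0..1} (\<lambda>t. frechet_derivative h (at (x + s (circ r t) v)) u / circ r t))) (at x)"
proof -
  obtain \<delta> r where d: "\<delta> > 0" "r > 0" "\<And>y \<zeta>. y \<in> ball x \<delta> \<Longrightarrow> cmod \<zeta> \<le> r \<Longrightarrow> y + s \<zeta> v \<in> S"
    using uniform_disc[OF \<open>open S\<close> \<open>x \<in> S\<close>] by metis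
  \<comment> \<open>The Leibniz rule wants the derivative of the integrand as a continuous map into
    bounded linear maps; in finite dimension continuity can be tested on
    \<open>Basis\<close>.\<close>
  define D where "D = (\<lambda>y t. Blinfun (\<lambda>u. frechet_derivative h (at (y + s (circ r t) v)) u / circ r t))"
  have D: "blinfun_apply (D y t) = (\<lambda>u. frechet_derivative h (at (y + s (circ r t) v)) u / circ r t)"
    if "y \<in> ball x \<delta>" for y t
    unfolding D_def
    by (intro bounded_linear_Blinfun_apply bounded_linear_compose[OF bounded_linear_divide]
        has_derivative_bounded_linear[OF holo_onD(1)[OF h d(3)[OF that]]])
       (use d(2) in \<open>simp add: norm_circ\<close>)
  have Dc: "continuous_on (ball x \<delta> \<times> cbox 0 1) (\<lambda>(y, t). D y t)"
  proof (rule continuous_on_blinfun_componentwise)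
    fix u :: 'e assume "u \<in> Basis"
    have "continuous_on (ball x \<delta> \<times> cbox 0 1)
        (\<lambda>p. frechet_derivative h (at (fst p + s (circ r (snd p)) v)) u / circ r (snd p))"
      by (intro continuous_intros continuous_on continuous_on_compose2
          [OF continuous_on_frechet_derivative[OF assms(1) h]])
         (use d in \<open>auto simp: norm_circ\<close>)
    then show "continuous_on (ball x \<delta> \<times> cbox 0 1) (\<lambda>p. blinfun_apply (case p of (y, t) \<Rightarrow> D y t) u)"
      by (rule continuous_on_eq) (auto simp: D)
  qed
  have hd: "((\<lambda>y. h (y + s (circ r t) v) / circ r t) has_derivative blinfun_apply (D y t)) (at y within ball x \<delta>)"
    if "y \<in> ball x \<delta>" for y t
  proof -
    have S: "y + s (circ r t) v \<in> S"
      using that d by (simp add: norm_circ)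
    have "((\<lambda>y. y + s (circ r t) v) has_derivative (\<lambda>u. u)) (at y)"
      using has_derivative_add[OF has_derivative_ident has_derivative_const] by simp
    then have "((\<lambda>y. h (y + s (circ r t) v)) has_derivative
        (\<lambda>u. frechet_derivative h (at (y + s (circ r t) v)) u)) (at y)"
      by (rule has_derivative_compose[where g=h and f="\<lambda>y. y + s (circ r t) v" and f'="\<lambda>u. u"
            and g'="frechet_derivative h (at (y + s (circ r t) v))"])
         (rule holo_onD(1)[OF h S])
    then show ?thesis
      unfolding D[OF that]
      by (rule has_derivative_at_withinI[OF bounded_linear.has_derivative[OF bounded_linear_divide]])
  qed
  have ic: "(\<lambda>t. h (y + s (circ r t) v) / circ r t) integrable_on cbox 0 1" if "y \<in> ball x \<delta>" for y
    by (intro integrable_continuous continuous_intros continuous_on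
        continuous_on_compose2[OF holo_on_imp_continuous_on[OF h]])
       (use d that in \<open>auto simp: norm_circ\<close>)
  have xd: "x \<in> ball x \<delta>" using d by simp
  have "((\<lambda>y. integral (cbox 0 1) (\<lambda>t. h (y + s (circ r t) v) / circ r t)) has_derivative
      blinfun_apply (integral (cbox 0 1) (D x))) (at x within ball x \<delta>)"
    by (rule leibniz_rule[OF hd ic Dc xd]) auto
  moreover have "blinfun_apply (integral (cbox 0 1) (D x)) =
      (\<lambda>u. integral (cbox 0 1) (\<lambda>t. frechet_derivative h (at (x + s (circ r t) v)) u / circ r t))"
  proof
    fix u
    have "D x integrable_on cbox 0 1"
      by (rule integrable_continuous, rule continuous_on_compose2[OF Dc, of _ "Pair x", simplified])
         (use d in \<open>auto intro!: continuous_intros\<close>)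
    then show "blinfun_apply (integral (cbox 0 1) (D x)) u =
        integral (cbox 0 1) (\<lambda>t. frechet_derivative h (at (x + s (circ r t) v)) u / circ r t)"
      using blinfun_apply_integral[of "D x" "cbox 0 1" u] by (simp add: D[OF xd])
  qed
  ultimately have "((\<lambda>y. integral (cbox 0 1) (\<lambda>t. h (y + s (circ r t) v) / circ r t)) has_derivative
      (\<lambda>u. integral {0..1} (\<lambda>t. frechet_derivative h (at (x + s (circ r t) v)) u / circ r t))) (at x)"
    using at_within_open[OF xd] by simp
  then have "((\<lambda>y. frechet_derivative h (at y) v) has_derivative
      (\<lambda>u. integral {0..1} (\<lambda>t. frechet_derivative h (at (x + s (circ r t) v)) u / circ r t))) (at x)"
    by (rule has_derivative_transform_within_open[OF _ open_ball xd])
       (use frechet_derivative_circle_mean[OF h d(2) d(3)] in simp)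
  then show ?thesis using d xd by blast
qed

text \<open>Complex linearity of the second derivative is inherited from the integrand, since a
  constant factor leaves the integral.\<close>

lemma holo_on_frechet_derivative:
  assumes "open S" "holo_on s (*) S h"
  shows "holo_on s (*) S (\<lambda>x. frechet_derivative h (at x) v)"
  unfolding holo_on_def
proof (intro ballI)
  fix x assume "x \<in> S"
  obtain r where r: "r > 0" "\<And>\<zeta>. cmod \<zeta> \<le> r \<Longrightarrow> x + s \<zeta> v \<in> S"
    "((\<lambda>y. frechet_derivative h (at y) v) has_derivative
      (\<lambda>u. integral {0..1} (\<lambda>t. frechet_derivative h (at (x + s (circ r t) v)) u / circ r t))) (at x)"
    using has_derivative_frechet_derivative[OF assms \<open>x \<in> S\<close>, of v] by blast
  have "x + s (circ r t) v \<in> S" for t using r by (simp add: norm_circ)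
  then have "frechet_derivative h (at (x + s (circ r t) v)) (s a u) / circ r t =
      a * (frechet_derivative h (at (x + s (circ r t) v)) u / circ r t)" for t a u
    using holo_onD(2)[OF assms(2)] by simp
  then show "\<exists>D. ((\<lambda>y. frechet_derivative h (at y) v) has_derivative D) (at x) \<and> (\<forall>a u. D (s a u) = a * D u)"
    by (intro exI[where x="\<lambda>u. integral {0..1}
        (\<lambda>t. frechet_derivative h (at (x + s (circ r t) v)) u / circ r t)"] conjI r(3))
       (simp only: integral_mult_right simp_thms)
qed

text \<open>Both sides are the circle mean of the first derivative in direction u: on the left by differentiation
  under the integral, on the right by Cauchy's formula.\<close>

lemma frechet_derivative_commute:
  assumes "open S" "holo_on s (*) S h" and "x \<in> S"
  shows "frechet_derivative (\<lambda>y. frechet_derivative h (at y) v) (at x) u =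
    frechet_derivative (\<lambda>y. frechet_derivative h (at y) u) (at x) v"
proof -
  obtain r where r: "r > 0" "\<And>\<zeta>. cmod \<zeta> \<le> r \<Longrightarrow> x + s \<zeta> v \<in> S"
    "((\<lambda>y. frechet_derivative h (at y) v) has_derivative
      (\<lambda>u. integral {0..1} (\<lambda>t. frechet_derivative h (at (x + s (circ r t) v)) u / circ r t))) (at x)"
    using has_derivative_frechet_derivative[OF assms(1,2) \<open>x \<in> S\<close>, of v] by blast
  have "frechet_derivative (\<lambda>y. frechet_derivative h (at y) u) (at x) v =
      integral {0..1} (\<lambda>t. frechet_derivative h (at (x + s (circ r t) v)) u / circ r t)"
    by (rule frechet_derivative_circle_mean[OF holo_on_frechet_derivative[OF assms(1,2)] r(1,2)])
  then show ?thesis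
    unfolding frechet_derivative_at[OF r(3), symmetric] by simp
qed

end

section \<open>Vector valued maps and the two scalings in use\<close>

lemma has_derivative_vec_nth:
  fixes f :: "'e::real_normed_vector \<Rightarrow> complex^'n"
  assumes "\<And>i. ((\<lambda>x. f x $ i) has_derivative (\<lambda>v. D v $ i)) (at x)"
  shows "(f has_derivative D) (at x)"
proof -
  have vec: "y = (\<Sum>i\<in>UNIV. axis i (y $ i))" for y :: "complex^'n"
    by (simp add: vec_eq_iff axis_def if_distrib sum.delta cong: if_cong)
  have "bounded_linear (axis i :: complex \<Rightarrow> complex^'n)" for i
    by (intro linear_conv_bounded_linear[THEN iffD1] linearI) (auto simp: axis_def vec_eq_iff)
  then have "((\<lambda>x. \<Sum>i\<in>UNIV. axis i (f x $ i)) has_derivative (\<lambda>v. \<Sum>i\<in>UNIV. axis i (D v $ i))) (at x)"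
    using bounded_linear.has_derivative[OF _ assms] by (intro has_derivative_sum) blast
  then show ?thesis using vec[symmetric] by simp
qed

lemma frechet_derivative_vec_nth:
  assumes "f differentiable (at x)"
  shows "frechet_derivative (\<lambda>y. f y $ i) (at x) v = frechet_derivative f (at x) v $ i"
proof -
  have "((\<lambda>y. f y $ i) has_derivative (\<lambda>v. frechet_derivative f (at x) v $ i)) (at x)"
    using assms bounded_linear.has_derivative[OF bounded_linear_vec_nth] frechet_derivative_works by blast
  from frechet_derivative_at[OF this] show ?thesis by metis
qed

lemma holo_on_vec_iff:
  "holo_on s (*s) S f \<longleftrightarrow> (\<forall>i. holo_on s (*) S (\<lambda>x. f x $ i))"
proof safe
  fix i assume f: "holo_on s (*s) S f"
  show "holo_on s (*) S (\<lambda>x. f x $ i)"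
    unfolding holo_on_def
  proof
    fix x assume x: "x \<in> S"
    have "((\<lambda>x. f x $ i) has_derivative (\<lambda>v. frechet_derivative f (at x) v $ i)) (at x)"
      by (rule bounded_linear.has_derivative[OF bounded_linear_vec_nth holo_onD(1)[OF f x]])
    then show "\<exists>D. ((\<lambda>x. f x $ i) has_derivative D) (at x) \<and> (\<forall>a v. D (s a v) = a * D v)"
      using holo_onD(2)[OF f x] by (intro exI[of _ "\<lambda>v. frechet_derivative f (at x) v $ i"]) simp
  qed
next
  assume f: "\<forall>i. holo_on s (*) S (\<lambda>x. f x $ i)"
  show "holo_on s (*s) S f"
    unfolding holo_on_def
  proof
    fix x assume x: "x \<in> S"
    let ?D = "\<lambda>v. \<chi> i. frechet_derivative (\<lambda>x. f x $ i) (at x) v"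
    have "(f has_derivative ?D) (at x)"
      by (rule has_derivative_vec_nth) (use holo_onD(1)[OF f[rule_format] x] in simp)
    moreover have "\<forall>a v. ?D (s a v) = a *s ?D v"
      using holo_onD(2)[OF f[rule_format] x] by (simp add: vec_eq_iff)
    ultimately show "\<exists>D. (f has_derivative D) (at x) \<and> (\<forall>a v. D (s a v) = a *s D v)" by blast
  qed
qed

lemma (in complex_scaling) holo_on_frechet_derivative_vec:
  assumes "open S" "holo_on s (*s) S f"
  shows "holo_on s (*s) S (\<lambda>x. frechet_derivative f (at x) v)"
  unfolding holo_on_vec_iff
proof
  fix i
  have "holo_on s (*) S (\<lambda>x. frechet_derivative (\<lambda>y. f y $ i) (at x) v)"
    using assms holo_on_frechet_derivative holo_on_vec_iff by blast
  moreover have "frechet_derivative (\<lambda>y. f y $ i) (at x) v = frechet_derivative f (at x) v $ i" if "x \<in> S" for x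
    using frechet_derivative_vec_nth holo_onD(1)[OF assms(2) that] differentiableI by blast
  ultimately show "holo_on s (*) S (\<lambda>x. frechet_derivative f (at x) v $ i)"
    unfolding holo_on_def
    by (metis (no_types, lifting) assms(1) has_derivative_transform_within_open)
qed

lemma norm_vector_smult: "norm (a *s v) = cmod a * norm (v :: complex^'n)"
  by (simp add: norm_vec_def L2_set_right_distrib norm_mult)

lemma bounded_bilinear_vector_smult: "bounded_bilinear ((*s) :: complex \<Rightarrow> complex^'n \<Rightarrow> complex^'n)"
  by unfold_locales
    (auto simp: vec_eq_iff algebra_simps norm_vector_smult intro!: exI[of _ 1])

interpretation cvec: complex_scaling "(*s) :: complex \<Rightarrow> complex^'n \<Rightarrow> complex^'n"
  by (simp add: complex_scaling_def bounded_bilinear_vector_smult)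

interpretation cvec2: complex_scaling "pair_scale :: complex \<Rightarrow> _ \<Rightarrow> (complex^'n) \<times> (complex^'n)"
  unfolding complex_scaling_def pair_scale_def split_beta
proof
  show "\<exists>K. \<forall>a b. norm (a *s fst b, a *s snd b :: complex^'n) \<le> norm a * norm (b :: (complex^'n) \<times> (complex^'n)) * K"
    by (rule exI[of _ 1]) (auto simp: norm_Pair norm_prod_def norm_vector_smult power_mult_distrib
        real_sqrt_mult simp flip: distrib_left)
qed (auto simp: vec_eq_iff algebra_simps)

section \<open>Metrics that are constant along a holomorphic frame\<close>

text \<open>\<open>P\<close> is the complex linear part of the real linear map \<open>L\<close>,
  hence determined by its values at the vectors \<open>axis i 1\<close>. For \<open>L\<close> the
  fibre derivative of \<open>f\<close> these values are the \<open>d_w i f\<close>.\<close>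

lemma wirtinger_linear:
  fixes L :: "complex^'n \<Rightarrow> complex"
  assumes "linear L"
  shows "(L b - \<i> * L (\<i> *s b)) / 2 = (\<Sum>i\<in>UNIV. b $ i * ((L (axis i 1) - \<i> * L (axis i \<i>)) / 2))"
proof -
  interpret linear L by fact
  define P where "P v = (L v - \<i> * L (\<i> *s v)) / 2" for v
  have P_add: "P (u + v) = P u + P v" for u v
    unfolding P_def cvec.add_right add by (simp add: field_simps)
  have P_scale: "P (a *s v) = a * P v" for a v
  proof -
    have *: "a *s v = Re a *\<^sub>R v + Im a *\<^sub>R (\<i> *s v)"
      "\<i> *s (a *s v) = Re a *\<^sub>R (\<i> *s v) - Im a *\<^sub>R v"
      by (simp_all add: vec_eq_iff complex_eq_iff algebra_simps)
    have L: "L (a *s v) = of_real (Re a) * L v + of_real (Im a) * L (\<i> *s v)"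
      "L (\<i> *s (a *s v)) = of_real (Re a) * L (\<i> *s v) - of_real (Im a) * L v"
      unfolding *(2) unfolding *(1) add diff scaleR by (simp_all add: scaleR_conv_of_real)
    have "(x * p + y * q - \<i> * (x * q - y * p)) / 2 = (x + \<i> * y) * ((p - \<i> * q) / 2)" for x y p q
      by (simp add: field_simps)
    moreover have "of_real (Re a) + \<i> * of_real (Im a) = a" by (simp add: complex_eq_iff)
    ultimately show ?thesis unfolding P_def L by metis
  qed
  have "P b = P (\<Sum>i\<in>UNIV. b $ i *s axis i 1)"
    by (simp add: basis_expansion)
  also have "\<dots> = (\<Sum>i\<in>UNIV. P (b $ i *s axis i 1))"
  proof -
    have "P 0 = 0" by (simp add: P_def zero cvec.zero_right)
    then show ?thesis by (intro sum_comp_morphism[symmetric, unfolded o_def]) (auto simp: P_add)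
  qed
  also have "\<dots> = (\<Sum>i\<in>UNIV. b $ i * P (axis i 1))"
    by (simp add: P_scale)
  moreover have "\<i> *s axis i 1 = (axis i \<i> :: complex^'n)" for i
    by (simp add: vec_eq_iff axis_def)
  ultimately show ?thesis by (simp add: P_def)
qed

lemma has_derivative_fiber:
  assumes "f differentiable (at (z, w))"
  shows "((\<lambda>w. f (z, w)) has_derivative (\<lambda>b. frechet_derivative f (at (z, w)) (0, b))) (at w)"
proof -
  have "((\<lambda>w. (z, w)) has_derivative (\<lambda>b. (0, b))) (at w)"
    by (auto intro!: derivative_eq_intros)
  then show ?thesis
    by (rule has_derivative_compose) (use assms frechet_derivative_works in blast)
qed

lemma linear_frechet_derivative_fiber:
  assumes "f differentiable (at (z, w))"
  shows "linear (\<lambda>b. frechet_derivative f (at (z, w)) (0, b))"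
  using has_derivative_linear[OF has_derivative_fiber[OF assms]] .

lemma d_w_linear_sum:
  assumes "f differentiable (at (z, w))"
  shows "(frechet_derivative f (at (z, w)) (0, b) - \<i> * frechet_derivative f (at (z, w)) (0, \<i> *s b)) / 2
    = (\<Sum>i\<in>UNIV. b $ i * d_w i f (z, w))"
  using wirtinger_linear[OF linear_frechet_derivative_fiber[OF assms]] by (simp add: d_w_def)

text \<open>Product rule in which the complex linear factors \<open>m i\<close> count as constants:
  their contributions in the directions \<open>axis j 1\<close> and \<open>axis j \<i>\<close>
  cancel. The identity is asked for off \<open>w = 0\<close> only, since G is smooth only there;
  this set is open, which suffices for differentiating.\<close>

lemma d_wbar_sum_linear:
  fixes m :: "'i::finite \<Rightarrow> complex^'n::finite \<Rightarrow> complex"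
  assumes f: "f differentiable (at (z, w))" and p: "\<And>i. p i differentiable (at (z, w))"
    and m: "\<And>i. linear (m i)" "\<And>i a v. m i (a *s v) = a * m i v"
    and w: "w \<noteq> 0" and eq: "\<And>w. w \<noteq> 0 \<Longrightarrow> f (z, w) = (\<Sum>i\<in>UNIV. p i (z, w) * m i w)"
  shows "d_wbar j f (z, w) = (\<Sum>i\<in>UNIV. d_wbar j (p i) (z, w) * m i w)"
proof -
  let ?D = "\<lambda>f b. frechet_derivative f (at (z, w)) (0, b)"
  have "((\<lambda>w. p i (z, w) * m i w) has_derivative (\<lambda>b. p i (z, w) * m i b + ?D (p i) b * m i w)) (at w)" for i
    by (intro has_derivative_mult has_derivative_fiber p linear_imp_has_derivative m)
  then have "((\<lambda>w. \<Sum>i\<in>UNIV. p i (z, w) * m i w) has_derivative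
      (\<lambda>b. \<Sum>i\<in>UNIV. p i (z, w) * m i b + ?D (p i) b * m i w)) (at w)"
    by (intro has_derivative_sum)
  then have "((\<lambda>w. f (z, w)) has_derivative (\<lambda>b. \<Sum>i\<in>UNIV. p i (z, w) * m i b + ?D (p i) b * m i w)) (at w)"
    by (rule has_derivative_transform_within_open[of _ _ _ _ "- {0}"]) (use w eq in auto)
  from has_derivative_unique[OF this has_derivative_fiber[OF f]]
  have D: "?D f b = (\<Sum>i\<in>UNIV. p i (z, w) * m i b + ?D (p i) b * m i w)" for b
    by metis
  have "axis j \<i> = \<i> *s (axis j 1 :: complex^'n)"
    by (simp add: vec_eq_iff axis_def)
  then have "m i (axis j \<i>) = \<i> * m i (axis j 1)" for i
    by (simp add: m(2))
  then show ?thesis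
    unfolding d_wbar_def D
    by (simp add: sum_distrib_left sum_divide_distrib add_divide_distrib algebra_simps flip: sum.distrib)
qed

lemma frechet_derivative_cnj:
  assumes "f differentiable (at x)"
  shows "frechet_derivative (\<lambda>x. cnj (f x)) (at x) v = cnj (frechet_derivative f (at x) v)"
proof -
  have "((\<lambda>x. cnj (f x)) has_derivative (\<lambda>v. cnj (frechet_derivative f (at x) v))) (at x)"
    by (intro bounded_linear.has_derivative[OF bounded_linear_cnj] assms[unfolded frechet_derivative_works])
  from frechet_derivative_at[OF this] show ?thesis by metis
qed

lemma d_w_cnj:
  assumes "f differentiable (at u)"
  shows "d_w i (\<lambda>u. cnj (f u)) u = cnj (d_wbar i f u)"
  by (simp add: d_w_def d_wbar_def frechet_derivative_cnj[OF assms])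

text \<open>Covers points without a derivative too: both functions have the same set of derivatives,
  and \<open>frechet_derivative\<close> is a choice from that set.\<close>

lemma frechet_derivative_cong_open:
  assumes "open S" "x \<in> S" "\<And>y. y \<in> S \<Longrightarrow> f y = g y"
  shows "frechet_derivative f (at x) = frechet_derivative g (at x)"
proof -
  have "(f has_derivative D) (at x) \<longleftrightarrow> (g has_derivative D) (at x)" for D
    using assms by (metis has_derivative_transform_within_open)
  then show ?thesis by (simp add: frechet_derivative_def)
qed

lemma differentiable_cong_open:
  assumes "open S" "x \<in> S" "\<And>y. y \<in> S \<Longrightarrow> f y = g y" "g differentiable (at x)"
  shows "f differentiable (at x)"
  using assms has_derivative_transform_within_open unfolding differentiable_def by metis

text \<open>Multiplying the equation for \<open>l\<close> by \<open>cnj (v $ l)\<close> and summing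
  gives the Hermitian form at \<open>v\<close>.\<close>

lemma hermitian_pos_def_kernel:
  assumes "hermitian_pos_def H" "\<And>l. (\<Sum>i\<in>UNIV. H $ i $ l * v $ i) = 0"
  shows "v = 0"
proof (rule ccontr)
  assume "v \<noteq> 0"
  then have "0 < Re (\<Sum>i\<in>UNIV. \<Sum>j\<in>UNIV. H $ i $ j * v $ i * cnj (v $ j))"
    using assms(1) unfolding hermitian_pos_def_def by blast
  also have "(\<Sum>i\<in>UNIV. \<Sum>j\<in>UNIV. H $ i $ j * v $ i * cnj (v $ j)) =
      (\<Sum>j\<in>UNIV. (\<Sum>i\<in>UNIV. H $ i $ j * v $ i) * cnj (v $ j))"
    by (subst sum.swap) (simp add: sum_distrib_right)
  finally show False using assms(2) by simp
qed

text \<open>The kernel lemma contracts the first index, so it shows injectivity of the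
  transpose.\<close>

lemma hermitian_pos_def_inverse:
  assumes "hermitian_pos_def H"
  shows "H ** matrix_inv H = mat 1"
proof -
  have "\<exists>B. B ** transpose H = mat 1"
  proof (rule iffD2[OF matrix_left_invertible_ker], intro allI impI)
    fix v assume "transpose H *v v = 0"
    then have "(\<Sum>i\<in>UNIV. H $ i $ l * v $ i) = 0" for l
      by (simp add: vec_eq_iff matrix_vector_mult_def transpose_def)
    then show "v = 0" by (rule hermitian_pos_def_kernel[OF assms])
  qed
  then have "invertible H"
    by (simp add: left_invertible_transpose invertible_right_inverse)
  then show ?thesis
    unfolding invertible_def matrix_inv_def by (rule someI2_ex) blast
qed

lemma differentiable_prod_finite:
  fixes f :: "'i \<Rightarrow> 'e::real_normed_vector \<Rightarrow> complex"
  assumes "finite I" "\<And>i. i \<in> I \<Longrightarrow> f i differentiable (at x)"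
  shows "(\<lambda>x. \<Prod>i\<in>I. f i x) differentiable (at x)"
  using assms by (induction I rule: finite_induct) auto

lemma differentiable_det:
  fixes M :: "'e::real_normed_vector \<Rightarrow> complex^'n^'n"
  assumes "\<And>i j. (\<lambda>x. M x $ i $ j) differentiable (at x)"
  shows "(\<lambda>x. det (M x)) differentiable (at x)"
  unfolding det_def
  by (intro differentiable_sum differentiable_mult differentiable_prod_finite assms ballI) auto

text \<open>The problem in a single chart, detached from the group: \<open>g\<close> stands for G,
  and \<open>E z v\<close> for the left translate of a fixed vector \<open>v\<close> at the unit.
  \<open>g_diff2\<close> speaks of directional derivatives because this is the form in which
  \<open>Ck_on\<close> provides second derivatives.\<close>

locale frame_invariant =
  fixes S :: "(complex^'n::finite) set"
    and g :: "(complex^'n) \<times> (complex^'n) \<Rightarrow> complex"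
    and E :: "complex^'n \<Rightarrow> complex^'n \<Rightarrow> complex^'n"
  assumes open_S: "open S"
    and g_real: "cnj (g u) = g u"
    and g_diff: "u \<in> S \<times> (UNIV - {0}) \<Longrightarrow> g differentiable (at u)"
    and g_diff2: "u \<in> S \<times> (UNIV - {0}) \<Longrightarrow> (\<lambda>u. frechet_derivative g (at u) b) differentiable (at u)"
    and g_pos: "u \<in> S \<times> (UNIV - {0}) \<Longrightarrow> hermitian_pos_def (hessian g u)"
    and E_holo: "holo_on (*s) (*s) S (\<lambda>z. E z v)"
    and E_add: "z \<in> S \<Longrightarrow> E z (v + v') = E z v + E z v'"
    and E_scale: "z \<in> S \<Longrightarrow> E z (a *s v) = a *s E z v"
    and E_inj: "z \<in> S \<Longrightarrow> E z v = 0 \<Longrightarrow> v = 0"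
    and g_inv: "z \<in> S \<Longrightarrow> z' \<in> S \<Longrightarrow> g (z, E z v) = g (z', E z' v)"
begin

section \<open>The inverse frame and the matrices C\<close>

definition "frame_mat z = (\<chi> i j. E z (axis j 1) $ i)"
text \<open>Cramer's rule makes the inverse frame visibly differentiable.\<close>

definition "coframe z w = (\<chi> k. det (\<chi> i j. if j = k then w $ i else frame_mat z $ i $ j) / det (frame_mat z))"
definition "DE z a v = frechet_derivative (\<lambda>z. E z v) (at z) a"
text \<open>For \<open>a = axis k 1\<close> this is \<open>C\<^sub>k(z) w\<close> of the
  overview.\<close>

definition "conn z a w = - DE z a (coframe z w)"

lemma E_sum: "z \<in> S \<Longrightarrow> E z v = (\<Sum>i\<in>UNIV. v $ i *s E z (axis i 1))"
proof -
  assume z: "z \<in> S"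
  have "E z 0 = 0" using E_scale[OF z, of 0 0] by simp
  then have "E z (\<Sum>i\<in>UNIV. v $ i *s axis i 1) = (\<Sum>i\<in>UNIV. E z (v $ i *s axis i 1))"
    by (intro sum_comp_morphism[symmetric, unfolded o_def]) (auto simp: E_add[OF z])
  then show ?thesis by (simp add: basis_expansion E_scale[OF z])
qed

lemma frame_mat_mult: "z \<in> S \<Longrightarrow> frame_mat z *v v = E z v"
  by (subst E_sum) (simp_all add: frame_mat_def matrix_vector_mult_def vec_eq_iff mult.commute)

lemma det_frame_mat: "z \<in> S \<Longrightarrow> det (frame_mat z) \<noteq> 0"
  unfolding invertible_det_nz[symmetric] invertible_left_inverse matrix_left_invertible_ker
  by (auto simp: frame_mat_mult E_inj)

lemma E_coframe: "z \<in> S \<Longrightarrow> E z (coframe z w) = w"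
  using cramer[OF det_frame_mat, of z "coframe z w" w] by (simp add: frame_mat_mult coframe_def)

lemma coframe_eqI: "z \<in> S \<Longrightarrow> E z v = w \<Longrightarrow> coframe z w = v"
  using cramer[OF det_frame_mat, of z v w] by (simp add: frame_mat_mult coframe_def)

lemma coframe_E: "z \<in> S \<Longrightarrow> coframe z (E z v) = v"
  by (rule coframe_eqI) simp_all

lemma coframe_add: "z \<in> S \<Longrightarrow> coframe z (w + w') = coframe z w + coframe z w'"
  by (rule coframe_eqI) (simp_all add: E_add E_coframe)

lemma coframe_scale: "z \<in> S \<Longrightarrow> coframe z (a *s w) = a *s coframe z w"
  by (rule coframe_eqI) (simp_all add: E_scale E_coframe)

lemma E_has_derivative: "z \<in> S \<Longrightarrow> ((\<lambda>z. E z v) has_derivative (\<lambda>a. DE z a v)) (at z)"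
  unfolding DE_def using holo_onD(1)[OF E_holo] by simp

lemma DE_unique:
  assumes "z \<in> S" "(f has_derivative D) (at z)" "\<And>z. z \<in> S \<Longrightarrow> f z = E z v"
  shows "DE z a v = D a"
  using has_derivative_unique[OF has_derivative_transform_within_open[OF assms(2) open_S assms(1,3)]
      E_has_derivative[OF assms(1)]] by metis

lemma DE_add: "z \<in> S \<Longrightarrow> DE z a (v + v') = DE z a v + DE z a v'"
  by (rule DE_unique[OF _ has_derivative_add[OF E_has_derivative E_has_derivative]]) (auto simp: E_add)

lemma DE_scale: "z \<in> S \<Longrightarrow> DE z a (c *s v) = c *s DE z a v"
  by (rule DE_unique[OF _ bounded_linear.has_derivative[OF cvec.bounded_linear_right E_has_derivative]])
     (auto simp: E_scale)

lemma DE_add_left: "z \<in> S \<Longrightarrow> DE z (a + a') v = DE z a v + DE z a' v"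
  by (simp add: linear_add[OF has_derivative_linear[OF E_has_derivative]])

lemma DE_scale_left: "z \<in> S \<Longrightarrow> DE z (c *s a) v = c *s DE z a v"
  unfolding DE_def by (rule holo_onD(2)[OF E_holo])

lemma DE_differentiable: "z \<in> S \<Longrightarrow> (\<lambda>z. DE z a v) differentiable (at z)"
  unfolding DE_def using holo_onD(1)[OF cvec.holo_on_frechet_derivative_vec[OF open_S E_holo]]
  by (auto intro: differentiableI)

lemma conn_add: "z \<in> S \<Longrightarrow> conn z a (w + w') = conn z a w + conn z a w'"
  by (simp add: conn_def coframe_add DE_add)

lemma conn_scale: "z \<in> S \<Longrightarrow> conn z a (c *s w) = c *s conn z a w"
  by (simp add: conn_def coframe_scale DE_scale vec_eq_iff)

lemma conn_add_left: "z \<in> S \<Longrightarrow> conn z (a + a') w = conn z a w + conn z a' w"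
  by (simp add: conn_def DE_add_left)

lemma conn_scale_left: "z \<in> S \<Longrightarrow> conn z (c *s a) w = c *s conn z a w"
  by (simp add: conn_def DE_scale_left vec_eq_iff)

lemma linear_conn_nth: "z \<in> S \<Longrightarrow> linear (\<lambda>w. conn z a w $ i)"
proof (rule linearI)
  fix r :: real and w :: "complex^'n" assume z: "z \<in> S"
  have "r *\<^sub>R w = complex_of_real r *s w" by (simp add: vec_eq_iff complex_eq_iff)
  then show "conn z a (r *\<^sub>R w) $ i = r *\<^sub>R conn z a w $ i"
    by (simp add: conn_scale[OF z] scaleR_conv_of_real)
qed (simp add: conn_add)

text \<open>\<open>Gam\<close> uses derivatives on the total space, so joint differentiability in
  base point and vector is required. In \<open>DE z a v\<close> the vector \<open>v\<close> moves
  along with the point; expanding it in the basis leaves products of coframe components with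
  functions of the base point alone.\<close>

lemma conn_differentiable:
  assumes "u \<in> S \<times> UNIV"
  shows "(\<lambda>u. conn (fst u) a (snd u) $ i) differentiable (at u)"
proof (rule differentiable_cong_open)
  show "open (S \<times> (UNIV :: (complex^'n) set))" by (simp add: open_Times open_S)
  have comp: "(\<lambda>u. f (fst u) $ i) differentiable (at u)" if "f differentiable (at (fst u))" for f :: "_ \<Rightarrow> complex^'n" and i
  proof -
    have "(\<lambda>u. f (fst u)) differentiable (at u)"
      using differentiable_chain_at[of fst u f] that by (simp add: o_def bounded_linear_imp_differentiable bounded_linear_fst)
    then show ?thesis
      using bounded_linear.has_derivative[OF bounded_linear_vec_nth] unfolding differentiable_def by blast
  qed
  have snd: "(\<lambda>u :: (complex^'n) \<times> (complex^'n). snd u $ i) differentiable (at u)" for i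
    by (intro bounded_linear_imp_differentiable bounded_linear_compose[OF bounded_linear_vec_nth bounded_linear_snd])
  have frame_mat: "(\<lambda>u. frame_mat (fst u) $ i $ j) differentiable (at u)" for i j
    unfolding frame_mat_def using comp[OF differentiableI[OF E_has_derivative]] assms by auto
  have coframe: "(\<lambda>u. coframe (fst u) (snd u) $ k) differentiable (at u)" for k
    unfolding coframe_def vec_lambda_beta
  proof (intro differentiable_divide differentiable_det frame_mat)
    show "(\<lambda>u. (\<chi> i j. if j = k then snd u $ i else frame_mat (fst u) $ i $ j) $ i $ j) differentiable (at u)" for i j
      by (cases "j = k") (simp_all add: snd frame_mat)
  qed (use assms in \<open>auto simp: det_frame_mat\<close>)
  show "(\<lambda>u. - (\<Sum>k\<in>UNIV. coframe (fst u) (snd u) $ k * DE (fst u) a (axis k 1) $ i)) differentiable (at u)"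
    using assms by (intro differentiable_minus differentiable_sum differentiable_mult coframe comp DE_differentiable ballI) auto
  fix u :: "(complex^'n) \<times> (complex^'n)" assume u: "u \<in> S \<times> UNIV"
  then have z: "fst u \<in> S" by auto
  have "DE (fst u) a 0 = 0" using DE_scale[OF z, of a 0 0] by simp
  then have "DE (fst u) a (\<Sum>k\<in>UNIV. v $ k *s axis k 1) = (\<Sum>k\<in>UNIV. DE (fst u) a (v $ k *s axis k 1))"
    for v :: "complex^'n"
    by (intro sum_comp_morphism[symmetric, unfolded o_def]) (auto simp: DE_add[OF z])
  from this[unfolded basis_expansion DE_scale[OF z], of "coframe (fst u) (snd u)"]
  show "conn (fst u) a (snd u) $ i = - (\<Sum>k\<in>UNIV. coframe (fst u) (snd u) $ k * DE (fst u) a (axis k 1) $ i)"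
    by (simp add: conn_def)
qed (use assms in auto)

section \<open>The connection of the metric\<close>

lemma open_Omega: "open (S \<times> (UNIV - {0 :: complex^'n}))"
  by (intro open_Times open_S) auto

lemma d_differentiable:
  assumes "u \<in> S \<times> (UNIV - {0})"
  shows "d_z i g differentiable (at u)" "d_w i g differentiable (at u)"
  unfolding d_z_def[abs_def] d_w_def[abs_def] divide_inverse
  by (intro differentiable_mult differentiable_diff g_diff2[OF assms] differentiable_const)+

text \<open>\<open>g\<close> is constant along the section given by \<open>E\<close> at a fixed
  \<open>v\<close>, so its derivative vanishes in the direction \<open>(a, DE z a v)\<close>; a
  derivative in z is thereby traded for one in w.\<close>

lemma d_z_eq:
  assumes z: "z \<in> S" and w: "w \<noteq> 0"
  shows "d_z k g (z, w) = (\<Sum>i\<in>UNIV. d_w i g (z, w) * conn z (axis k 1) w $ i)"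
proof -
  \<comment> \<open>Chosen so that the section passes through \<open>w\<close> over
    \<open>z\<close>.\<close>
  define v where "v = coframe z w"
  have Ev: "E z v = w" by (simp add: v_def E_coframe z)
  let ?D = "frechet_derivative g (at (z, w))"
  have g: "g differentiable (at (z, w))" by (rule g_diff) (use z w in auto)
  then have gD: "(g has_derivative ?D) (at (z, w))" using frechet_derivative_works by blast
  then have lin: "linear ?D" by (rule has_derivative_linear)
  have "((\<lambda>z. (z, E z v)) has_derivative (\<lambda>a. (a, DE z a v))) (at z)"
    by (intro has_derivative_Pair has_derivative_ident E_has_derivative z)
  then have "((\<lambda>z. g (z, E z v)) has_derivative (\<lambda>a. ?D (a, DE z a v))) (at z)"
    by (rule has_derivative_compose) (simp add: Ev gD)
  then have "((\<lambda>_. g (z, E z v)) has_derivative (\<lambda>a. ?D (a, DE z a v))) (at z)"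
    by (rule has_derivative_transform_within_open[OF _ open_S z]) (rule g_inv[OF _ z])
  from has_derivative_unique[OF this has_derivative_const]
  have "?D (a, DE z a v) = 0" for a by metis
  moreover have "(a, DE z a v) = (a, 0) - (0, conn z a w)" for a
    by (simp add: conn_def v_def)
  ultimately have D: "?D (a, 0) = ?D (0, conn z a w)" for a
    using linear_diff[OF lin] by (metis eq_iff_diff_eq_0)
  \<comment> \<open>Complex linearity of \<open>conn\<close> in its direction argument turns the
    Wirtinger combination in z into the one in w.\<close>
  have "axis k \<i> = \<i> *s (axis k 1 :: complex^'n)"
    by (simp add: vec_eq_iff axis_def)
  then have "d_z k g (z, w) = (?D (0, conn z (axis k 1) w) - \<i> * ?D (0, \<i> *s conn z (axis k 1) w)) / 2"
    by (simp add: d_z_def D conn_scale_left[OF z])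
  then show ?thesis
    unfolding d_w_linear_sum[OF g] by (simp add: mult.commute)
qed

text \<open>The two orders of differentiation are exchanged by means of the Hermitian symmetry of the Hessian.\<close>

lemma hessian_eq:
  assumes u: "u \<in> S \<times> (UNIV - {0})"
  shows "d_wbar j (d_w i g) u = hessian g u $ i $ j"
proof -
  have cnj: "d_wbar k g u = cnj (d_w k g u)" if "u \<in> S \<times> (UNIV - {0})" for u k
    using d_w_cnj[OF g_diff[OF that], of k] by (simp add: g_real)
  have "frechet_derivative (d_wbar i g) (at u) = frechet_derivative (\<lambda>u. cnj (d_w i g u)) (at u)"
    by (rule frechet_derivative_cong_open[OF open_Omega u cnj])
  then have "hessian g u $ j $ i = d_w j (\<lambda>u. cnj (d_w i g u)) u"
    by (simp add: hessian_def d_w_def[of j])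
  also have "\<dots> = cnj (d_wbar j (d_w i g) u)"
    by (rule d_w_cnj[OF d_differentiable(2)[OF u]])
  finally show ?thesis
    using g_pos[OF u] unfolding hermitian_pos_def_def by (metis complex_cnj_cnj)
qed

text \<open>Applying \<open>d_wbar j\<close> to \<open>d_z_eq\<close> affects only the factors
  \<open>d_w l g\<close>, which become Hessian entries; the inverse Hessian then cancels
  them.\<close>

lemma Nconn_eq:
  assumes z: "z \<in> S" and w: "w \<noteq> 0"
  shows "Nconn g i k (z, w) = conn z (axis k 1) w $ i"
proof -
  have zw: "(z, w) \<in> S \<times> (UNIV - {0})" using z w by auto
  let ?H = "hessian g (z, w)"
  have d: "d_wbar j (d_z k g) (z, w) = (\<Sum>l\<in>UNIV. ?H $ l $ j * conn z (axis k 1) w $ l)" for j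
    unfolding hessian_eq[OF zw, symmetric]
  proof (rule d_wbar_sum_linear[OF d_differentiable(1)[OF zw] d_differentiable(2)[OF zw] linear_conn_nth[OF z] _ w])
    show "conn z (axis k 1) (a *s v) $ i = a * conn z (axis k 1) v $ i" for i a v
      by (simp add: conn_scale[OF z])
  qed (rule d_z_eq[OF z])
  have "(\<Sum>j\<in>UNIV. matrix_inv ?H $ j $ i * (\<Sum>l\<in>UNIV. ?H $ l $ j * c l))
      = (\<Sum>l\<in>UNIV. c l * (?H ** matrix_inv ?H) $ l $ i)" for c
    unfolding sum_distrib_left by (subst sum.swap) (simp add: matrix_matrix_mult_def sum_distrib_left mult_ac)
  then show ?thesis
    unfolding Nconn_def d hermitian_pos_def_inverse[OF g_pos[OF zw]]
    by (simp add: mat_def if_distrib cong: if_cong)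
qed

text \<open>By \<open>Nconn_eq\<close> the connection is linear in \<open>w\<close>, so its
  derivative is a coefficient and \<open>w\<close> drops out. This makes it possible to compare the
  conditions at different points of one fibre.\<close>

lemma Gam_eq:
  assumes z: "z \<in> S" and w: "w \<noteq> 0"
  shows "Gam g i j k (z, w) = conn z (axis k 1) (axis j 1) $ i"
proof -
  have zw: "(z, w) \<in> S \<times> (UNIV - {0})" using z w by auto
  let ?f = "\<lambda>u. conn (fst u) (axis k 1) (snd u) $ i"
  have f: "?f differentiable (at (z, w))" by (rule conn_differentiable) (use z in auto)
  have "((\<lambda>w. ?f (z, w)) has_derivative (\<lambda>b. conn z (axis k 1) b $ i)) (at w)"
    using linear_imp_has_derivative[OF linear_conn_nth[OF z]] by simp
  from has_derivative_unique[OF this has_derivative_fiber[OF f]]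
  have D: "frechet_derivative ?f (at (z, w)) (0, b) = conn z (axis k 1) b $ i" for b
    by metis
  have "frechet_derivative (Nconn g i k) (at (z, w)) = frechet_derivative ?f (at (z, w))"
    by (rule frechet_derivative_cong_open[OF open_Omega zw]) (auto intro!: Nconn_eq)
  moreover have "axis j \<i> = \<i> *s (axis j 1 :: complex^'n)"
    by (simp add: vec_eq_iff axis_def)
  ultimately show ?thesis
    unfolding Gam_def d_w_def[of j] by (simp add: D conn_scale[OF z])
qed

section \<open>Torsion and the three conditions at a base point\<close>

text \<open>The tensor T of the overview; it equals the antisymmetrised \<open>Gam\<close> at every
  nonzero \<open>w\<close>.\<close>

definition "torsion z i j k = conn z (axis k 1) (axis j 1) $ i - conn z (axis j 1) (axis k 1) $ i"

text \<open>Zero torsion means that the bilinear map \<open>conn z\<close> is symmetric on basis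
  vectors, hence everywhere. As \<open>E z\<close> is bijective, both arguments may be written as
  frame vectors, which the coframe inside \<open>conn\<close> undoes. The right side is the
  vanishing of the brackets of the fields given by \<open>E\<close> at fixed \<open>v\<close> and
  \<open>v'\<close>.\<close>

lemma torsion_zero_iff:
  assumes z: "z \<in> S"
  shows "(\<forall>i j k. torsion z i j k = 0) \<longleftrightarrow> (\<forall>v v'. DE z (E z v) v' = DE z (E z v') v)"
proof
  assume *: "\<forall>i j k. torsion z i j k = 0"
  have C0: "conn z 0 w = 0" "conn z w 0 = 0" for w
    using conn_scale[OF z, of w 0 0] conn_scale_left[OF z, of 0 0 w] by simp_all
  have expand: "conn z a b = (\<Sum>k\<in>UNIV. \<Sum>j\<in>UNIV. (b $ j * a $ k) *s conn z (axis k 1) (axis j 1))" for a b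
  proof -
    have "conn z a b = conn z (\<Sum>k\<in>UNIV. a $ k *s axis k 1) (\<Sum>k\<in>UNIV. b $ k *s axis k 1)"
      by (simp add: basis_expansion)
    also have "\<dots> = (\<Sum>k\<in>UNIV. conn z (a $ k *s axis k 1) (\<Sum>k\<in>UNIV. b $ k *s axis k 1))"
      by (rule sum_comp_morphism[symmetric, unfolded o_def]) (auto simp: conn_add_left[OF z] C0)
    also have "\<dots> = (\<Sum>k\<in>UNIV. \<Sum>j\<in>UNIV. conn z (a $ k *s axis k 1) (b $ j *s axis j 1))"
      by (rule sum.cong[OF refl], rule sum_comp_morphism[symmetric, unfolded o_def])
         (auto simp: conn_add[OF z] C0)
    finally show ?thesis by (simp add: conn_scale[OF z] conn_scale_left[OF z] vector_smult_assoc)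
  qed
  have sym: "conn z (axis k 1) (axis j 1) = conn z (axis j 1) (axis k 1)" for j k
    using * by (simp add: torsion_def vec_eq_iff)
  have "conn z a b = conn z b a" for a b
    unfolding expand[of a b] expand[of b a]
    by (subst sum.swap) (intro sum.cong refl, simp only: sym mult.commute)
  from this[of "E z v" "E z v'" for v v']
  show "\<forall>v v'. DE z (E z v) v' = DE z (E z v') v" by (simp add: conn_def coframe_E[OF z])
next
  assume "\<forall>v v'. DE z (E z v) v' = DE z (E z v') v"
  then have "conn z a b = conn z b a" for a b
    unfolding conn_def by (metis E_coframe[OF z])
  then show "\<forall>i j k. torsion z i j k = 0" by (metis torsion_def diff_self)
qed

lemma weakly_imp_torsion_zero:
  assumes z: "z \<in> S"
    and weak: "\<And>w j. w \<noteq> 0 \<Longrightarrow> (\<Sum>i\<in>UNIV. \<Sum>k\<in>UNIV. w $ k * torsion z i j k * d_w i g (z, w)) = 0"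
  shows "torsion z i j k = 0"
proof -
  define m where "m i w = (\<Sum>k\<in>UNIV. w $ k * torsion z i j k)" for i w
  have m: "linear (m i)" "m i (a *s v) = a * m i v" for i a v
    by (auto intro!: linearI simp: m_def algebra_simps sum.distrib sum_distrib_left scaleR_sum_right)
  have "m i w = 0" if w: "w \<noteq> 0" for i w
  proof -
    have zw: "(z, w) \<in> S \<times> (UNIV - {0})" using z w by auto
    \<comment> \<open>The weak condition expands the zero function in the factors
      \<open>d_w i g\<close> and \<open>m i\<close>; its conjugate derivative gives a linear system
      with the Hessian as matrix.\<close>
    have "d_wbar l (\<lambda>_. 0) (z, w) = (\<Sum>i\<in>UNIV. d_wbar l (d_w i g) (z, w) * m i w)" for l
    proof (rule d_wbar_sum_linear)
      show "0 = (\<Sum>i\<in>UNIV. d_w i g (z, w') * m i w')" if "w' \<noteq> 0" for w'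
        using weak[OF that, of j] by (simp add: m_def sum_distrib_left mult_ac)
    qed (use z w zw m in \<open>auto simp: d_differentiable\<close>)
    moreover have "d_wbar l (\<lambda>_. 0) (z, w) = 0" for l
      by (simp add: d_wbar_def)
    ultimately have "(\<Sum>i\<in>UNIV. hessian g (z, w) $ i $ l * (\<chi> i. m i w) $ i) = 0" for l
      unfolding hessian_eq[OF zw] by simp
    from hermitian_pos_def_kernel[OF g_pos[OF zw] this] show ?thesis by (simp add: vec_eq_iff)
  qed
  \<comment> \<open>At a basis vector the contraction with \<open>w\<close> is a single coefficient
    of the torsion.\<close>
  from this[of "axis k 1" i] have "m i (axis k 1) = 0"
    by (simp add: axis_eq_0_iff)
  then show ?thesis
    by (simp add: m_def axis_def if_distrib[of "\<lambda>x. x * _"] cong: if_cong)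
qed

text \<open>The implications form a cycle. From strong to Kaehler to weak one only contracts; the
  way back from weak carries the content.\<close>

lemma kaehler_conditions:
  assumes z: "z \<in> S"
  shows "(\<forall>w. w \<noteq> 0 \<longrightarrow> (\<forall>i j k. Gam g i j k (z, w) - Gam g i k j (z, w) = 0)) \<longleftrightarrow>
      (\<forall>v v'. DE z (E z v) v' = DE z (E z v') v)" (is "?strong \<longleftrightarrow> ?sym")
    and "(\<forall>w. w \<noteq> 0 \<longrightarrow> (\<forall>i j. (\<Sum>k\<in>UNIV. w $ k * (Gam g i j k (z, w) - Gam g i k j (z, w))) = 0)) \<longleftrightarrow>
      (\<forall>v v'. DE z (E z v) v' = DE z (E z v') v)" (is "?kaehler \<longleftrightarrow> _")
    and "(\<forall>w. w \<noteq> 0 \<longrightarrow> (\<forall>j. (\<Sum>i\<in>UNIV. \<Sum>k\<in>UNIV. w $ k *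
        (Gam g i j k (z, w) - Gam g i k j (z, w)) * d_w i g (z, w)) = 0)) \<longleftrightarrow>
      (\<forall>v v'. DE z (E z v) v' = DE z (E z v') v)" (is "?weakly \<longleftrightarrow> _")
proof -
  have T: "Gam g i j k (z, w) - Gam g i k j (z, w) = torsion z i j k" if "w \<noteq> 0" for i j k w
    by (simp add: Gam_eq[OF z that] torsion_def)
  have 1: ?strong if ?sym
    using that T unfolding torsion_zero_iff[OF z, symmetric] by simp
  have 2: ?kaehler if ?strong using that by simp
  have 3: ?weakly if k: ?kaehler
  proof (intro allI impI)
    fix w j assume "(w :: complex^'n) \<noteq> 0"
    then have "(\<Sum>k\<in>UNIV. w $ k * (Gam g i j k (z, w) - Gam g i k j (z, w)) * d_w i g (z, w)) = 0" for i
      using k unfolding sum_distrib_right[symmetric] by simp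
    then show "(\<Sum>i\<in>UNIV. \<Sum>k\<in>UNIV. w $ k *
        (Gam g i j k (z, w) - Gam g i k j (z, w)) * d_w i g (z, w)) = 0" by simp
  qed
  have 4: ?sym if ?weakly
    unfolding torsion_zero_iff[OF z, symmetric]
    using weakly_imp_torsion_zero[OF z] that by (simp add: T)
  from 1 2 3 4 show "?strong \<longleftrightarrow> ?sym" "?kaehler \<longleftrightarrow> ?sym" "?weakly \<longleftrightarrow> ?sym" by blast+
qed

end

section \<open>Tangent vectors and brackets in charts\<close>

lemma holo_on_compose:
  assumes "holo_on s t S f" "holo_on t r T g" "f ` S \<subseteq> T"
  shows "holo_on s r S (\<lambda>x. g (f x))"
  unfolding holo_on_def
proof
  fix x assume x: "x \<in> S"
  then have fx: "f x \<in> T" using assms(3) by auto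
  have "((\<lambda>x. g (f x)) has_derivative (\<lambda>v. frechet_derivative g (at (f x)) (frechet_derivative f (at x) v))) (at x)"
    by (rule has_derivative_compose[OF holo_onD(1)[OF assms(1) x] holo_onD(1)[OF assms(2) fx]])
  then show "\<exists>D. ((\<lambda>x. g (f x)) has_derivative D) (at x) \<and> (\<forall>a v. D (s a v) = r a (D v))"
    using holo_onD(2)[OF assms(1) x] holo_onD(2)[OF assms(2) fx] by (intro exI conjI) auto
qed

lemma holo_on_cong_open:
  assumes "open S" "\<And>x. x \<in> S \<Longrightarrow> f x = g x" "holo_on s t S g"
  shows "holo_on s t S f"
  using assms has_derivative_transform_within_open unfolding holo_on_def by metis

lemma holo_on_subset: "holo_on s t S f \<Longrightarrow> T \<subseteq> S \<Longrightarrow> holo_on s t T f"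
  by (auto simp: holo_on_def)

locale complex_mfd =
  fixes X :: "'a topology" and A :: "('a, 'n::finite) chart set"
  assumes mfd: "complex_manifold X A"
begin

lemma
  assumes "c \<in> A"
  shows openin_dom: "openin X (dom_of c)"
    and open_img: "open (img c)"
    and homeo: "homeomorphic_map (subtopology X (dom_of c)) (subtopology euclidean (img c)) (coord c)"
  using mfd assms by (auto simp: complex_manifold_def is_chart_def)

lemma dom_subset: "c \<in> A \<Longrightarrow> dom_of c \<subseteq> topspace X"
  using openin_dom openin_subset by blast

lemma ex_chart: "p \<in> topspace X \<Longrightarrow> \<exists>c\<in>A. p \<in> dom_of c"
  using mfd unfolding complex_manifold_def by blast

lemma inj_on_coord: "c \<in> A \<Longrightarrow> inj_on (coord c) (dom_of c)"
  using homeomorphic_imp_injective_map[OF homeo] dom_subset by (simp add: Int_absorb1)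

lemma param_coord [simp]: "c \<in> A \<Longrightarrow> p \<in> dom_of c \<Longrightarrow> param c (coord c p) = p"
  by (simp add: inj_on_coord)

lemma coord_param [simp]: "z \<in> img c \<Longrightarrow> coord c (param c z) = z"
  by (rule f_inv_into_f)

lemma param_in_dom [simp]: "z \<in> img c \<Longrightarrow> param c z \<in> dom_of c"
  by (rule inv_into_into)

lemma coord_image: "c \<in> A \<Longrightarrow> coord c ` (dom_of c \<inter> U) = {z \<in> img c. param c z \<in> U}"
  by (auto simp: image_iff)

lemma open_param_vimage:
  assumes "c \<in> A" "openin X U"
  shows "open {z \<in> img c. param c z \<in> U}"
proof -
  have "openin (subtopology X (dom_of c)) (dom_of c \<inter> U)"
    using assms(2) by (simp add: openin_subtopology_Int2)
  then have "openin (top_of_set (img c)) (coord c ` (dom_of c \<inter> U))"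
    using homeomorphic_imp_open_map[OF homeo[OF assms(1)]] by (simp add: open_map_def)
  then show ?thesis
    using open_img[OF assms(1)] openin_open_trans by (metis coord_image[OF assms(1)])
qed

lemma openin_coord_vimage:
  assumes "c \<in> A" "open T"
  shows "openin X {q \<in> dom_of c. coord c q \<in> T}"
proof -
  have "openin (top_of_set (img c)) (img c \<inter> T)"
    using assms(2) by auto
  from openin_continuous_map_preimage[OF homeomorphic_imp_continuous_map[OF homeo[OF assms(1)]] this]
  have "openin (subtopology X (dom_of c)) {q \<in> dom_of c. coord c q \<in> T}"
    using dom_subset[OF assms(1)] by (auto elim!: back_subst[of "openin _"])
  then show ?thesis using openin_dom[OF assms(1)] openin_trans_full by blast
qed

lemma continuous_map_param: "c \<in> A \<Longrightarrow> continuous_map (top_of_set (img c)) X (param c)"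
  unfolding continuous_map_def
proof (intro conjI allI impI)
  assume c: "c \<in> A"
  show "param c \<in> topspace (top_of_set (img c)) \<rightarrow> topspace X"
    using dom_subset[OF c] param_in_dom by auto
  fix U assume "openin X U"
  from open_param_vimage[OF c this]
  show "openin (top_of_set (img c)) {z \<in> topspace (top_of_set (img c)). param c z \<in> U}"
    by (simp add: open_subset Collect_restrict)
qed

lemma transition_holo:
  assumes "c \<in> A" "d \<in> A"
  shows "holo_on (*s) (*s) {z \<in> img c. param c z \<in> dom_of d} (\<lambda>z. coord d (param c z))"
  using mfd assms unfolding complex_manifold_def compatible_def coord_image[OF assms(1), symmetric]
  by (auto simp: o_def)

section \<open>Germs and tangent vectors\<close>

text \<open>Transition maps carry holomorphy from one chart around \<open>p\<close> to all others,
  so a single chart decides.\<close>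

lemma holo_near_iff:
  assumes c: "c \<in> A" and p: "p \<in> dom_of c"
  shows "holo_near X A p h \<longleftrightarrow>
    (\<exists>T. open T \<and> coord c p \<in> T \<and> T \<subseteq> img c \<and> holo_on (*s) (*) T (\<lambda>z. h (param c z)))"
proof
  assume "holo_near X A p h"
  then obtain U where U: "openin X U" "p \<in> U"
    "holo_on (*s) (*) (coord c ` (dom_of c \<inter> U)) (h \<circ> param c)"
    unfolding holo_near_def using c by blast
  then show "\<exists>T. open T \<and> coord c p \<in> T \<and> T \<subseteq> img c \<and> holo_on (*s) (*) T (\<lambda>z. h (param c z))"
    using p c open_param_vimage[OF c U(1)] unfolding coord_image[OF c]
    by (intro exI[of _ "{z \<in> img c. param c z \<in> U}"]) (auto simp: o_def)
next
  assume "\<exists>T. open T \<and> coord c p \<in> T \<and> T \<subseteq> img c \<and> holo_on (*s) (*) T (\<lambda>z. h (param c z))"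
  then obtain T where T: "open T" "coord c p \<in> T" "T \<subseteq> img c" "holo_on (*s) (*) T (\<lambda>z. h (param c z))"
    by blast
  let ?U = "{q \<in> dom_of c. coord c q \<in> T}"
  have U: "openin X ?U" by (rule openin_coord_vimage[OF c T(1)])
  have "holo_on (*s) (*) (coord d ` (dom_of d \<inter> ?U)) (h \<circ> param d)" if d: "d \<in> A" for d
    unfolding coord_image[OF d]
  proof (rule holo_on_cong_open)
    show "open {z \<in> img d. param d z \<in> ?U}" by (rule open_param_vimage[OF d U])
    have "holo_on (*s) (*s) {z \<in> img d. param d z \<in> ?U} (\<lambda>z. coord c (param d z))"
      by (rule holo_on_subset[OF transition_holo[OF d c]]) auto
    then show "holo_on (*s) (*) {z \<in> img d. param d z \<in> ?U} (\<lambda>z. h (param c (coord c (param d z))))"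
      by (rule holo_on_compose[OF _ T(4)]) auto
  qed (use c in auto)
  then show "holo_near X A p h"
    unfolding holo_near_def using U p T(2) by blast
qed

lemma holo_near_cong:
  assumes "openin X U" "p \<in> U" "\<And>q. q \<in> U \<Longrightarrow> h q = h' q" "holo_near X A p h"
  shows "holo_near X A p h'"
proof -
  have "p \<in> topspace X" using assms(1,2) openin_subset by blast
  then obtain c where c: "c \<in> A" "p \<in> dom_of c" using ex_chart by blast
  obtain T where T: "open T" "coord c p \<in> T" "T \<subseteq> img c" "holo_on (*s) (*) T (\<lambda>z. h (param c z))"
    using assms(4) unfolding holo_near_iff[OF c] by blast
  let ?T = "T \<inter> {z \<in> img c. param c z \<in> U}"
  have o: "open ?T" using T(1) open_param_vimage[OF c(1) assms(1)] by blast
  have "holo_on (*s) (*) ?T (\<lambda>z. h' (param c z))"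
    by (rule holo_on_cong_open[OF o _ holo_on_subset[OF T(4)]]) (auto simp: assms(3))
  then show ?thesis
    unfolding holo_near_iff[OF c] using o T c assms(2) by (intro exI[of _ ?T]) auto
qed

lemma holo_near_derivative:
  assumes c: "c \<in> A" "p \<in> dom_of c" and h: "holo_near X A p h"
  shows "((\<lambda>z. h (param c z)) has_derivative frechet_derivative (\<lambda>z. h (param c z)) (at (coord c p))) (at (coord c p))"
    and "frechet_derivative (\<lambda>z. h (param c z)) (at (coord c p)) (a *s v) =
      a * frechet_derivative (\<lambda>z. h (param c z)) (at (coord c p)) v"
  using h holo_onD unfolding holo_near_iff[OF c] by blast+

lemma tvec_apply:
  assumes c: "c \<in> A" "p \<in> dom_of c" and h: "holo_near X A p h"
  shows "tvec X A c p w h = frechet_derivative (\<lambda>z. h (param c z)) (at (coord c p)) w"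
proof -
  let ?D = "frechet_derivative (\<lambda>z. h (param c z)) (at (coord c p))"
  have lin: "linear ?D" using has_derivative_linear[OF holo_near_derivative(1)[OF assms]] .
  have "?D w = ?D (\<Sum>i\<in>UNIV. w $ i *s axis i 1)" by (simp add: basis_expansion)
  also have "\<dots> = (\<Sum>i\<in>UNIV. w $ i * ?D (axis i 1))"
    unfolding linear_sum[OF lin] holo_near_derivative(2)[OF assms] ..
  finally show ?thesis using h by (simp add: tvec_def o_def)
qed

lemma tvec_not_holo: "\<not> holo_near X A p h \<Longrightarrow> tvec X A c p w h = 0"
  by (simp add: tvec_def)

text \<open>Group laws hold on the carrier only, so functions composed with translations agree with
  the intended ones merely there; locality bridges this.\<close>

lemma tvec_local:
  assumes c: "c \<in> A" "p \<in> dom_of c" and U: "openin X U" "p \<in> U" "\<And>q. q \<in> U \<Longrightarrow> h q = h' q"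
  shows "tvec X A c p w h = tvec X A c p w h'"
proof -
  have iff: "holo_near X A p h \<longleftrightarrow> holo_near X A p h'"
    using holo_near_cong[OF U(1,2)] U(3) by metis
  have "frechet_derivative (\<lambda>z. h (param c z)) (at (coord c p)) =
      frechet_derivative (\<lambda>z. h' (param c z)) (at (coord c p))"
    by (rule frechet_derivative_cong_open[OF open_param_vimage[OF c(1) U(1)]]) (use c U in auto)
  then show ?thesis using tvec_apply[OF c] iff tvec_not_holo by metis
qed

text \<open>Coordinate functions are the test functions that recover the components of a tangent
  vector.\<close>

lemma holo_near_coord:
  assumes c: "c \<in> A" "p \<in> dom_of c"
  shows "holo_near X A p (\<lambda>q. coord c q $ i)"
proof -
  have "holo_on (*s) (*) (img c) (\<lambda>z. coord c (param c z) $ i)"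
  proof -
    have "{z \<in> img c. param c z \<in> dom_of c} = img c" by auto
    then show ?thesis using transition_holo[OF c(1) c(1)] by (simp add: holo_on_vec_iff)
  qed
  then show ?thesis
    unfolding holo_near_iff[OF c] using open_img[OF c(1)] c by (intro exI[of _ "img c"]) auto
qed

lemma tvec_coord:
  assumes c: "c \<in> A" "p \<in> dom_of c"
  shows "tvec X A c p w (\<lambda>q. coord c q $ i) = w $ i"
proof -
  have "((\<lambda>z. z $ i) has_derivative (\<lambda>w. w $ i)) (at (coord c p))"
    by (rule bounded_linear_imp_has_derivative[OF bounded_linear_vec_nth])
  then have "((\<lambda>z. coord c (param c z) $ i) has_derivative (\<lambda>w. w $ i)) (at (coord c p))"
    by (rule has_derivative_transform_within_open[OF _ open_img[OF c(1)]]) (use c in auto)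
  from frechet_derivative_at[OF this] show ?thesis
    unfolding tvec_apply[OF c holo_near_coord[OF c]] by metis
qed

lemma tvec_inject: "c \<in> A \<Longrightarrow> p \<in> dom_of c \<Longrightarrow> tvec X A c p w = tvec X A c p w' \<longleftrightarrow> w = w'"
  using tvec_coord by (metis vec_eq_iff)

lemma tvec_0: "tvec X A c p 0 = (\<lambda>h. 0)"
  by (auto simp: tvec_def)

text \<open>Both iterated derivatives of \<open>h\<close> contain a second derivative term in the
  directions of \<open>a\<close> and \<open>b\<close>; the two terms cancel by
  \<open>frechet_derivative_commute\<close>.\<close>

lemma lie_bracket_tvec:
  assumes c: "c \<in> A" and p: "p \<in> dom_of c"
    and V: "\<And>q. q \<in> dom_of c \<Longrightarrow> V q = tvec X A c q (a (coord c q))"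
    and W: "\<And>q. q \<in> dom_of c \<Longrightarrow> W q = tvec X A c q (b (coord c q))"
    and a: "holo_on (*s) (*s) (img c) a" and b: "holo_on (*s) (*s) (img c) b"
  shows "lie_bracket X A V W p = tvec X A c p
    (frechet_derivative b (at (coord c p)) (a (coord c p)) - frechet_derivative a (at (coord c p)) (b (coord c p)))"
proof
  fix h
  let ?z = "coord c p"
  show "lie_bracket X A V W p h = tvec X A c p
    (frechet_derivative b (at ?z) (a ?z) - frechet_derivative a (at ?z) (b ?z)) h"
  proof (cases "holo_near X A p h")
    case False
    then show ?thesis by (simp add: lie_bracket_def tvec_not_holo)
  next
    case h: True
    then obtain T where T: "open T" "?z \<in> T" "T \<subseteq> img c" "holo_on (*s) (*) T (\<lambda>z. h (param c z))"
      unfolding holo_near_iff[OF c p] by blast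
    define k where "k = (\<lambda>z. h (param c z))"
    let ?dk = "\<lambda>z v. frechet_derivative k (at z) v"
    have k: "holo_on (*s) (*) T k" using T(4) by (simp add: k_def)
    have lin: "linear (?dk z)" if "z \<in> T" for z
      using holo_onD(1)[OF k that] by (rule has_derivative_linear)
    have sum: "?dk z v = (\<Sum>i\<in>UNIV. v $ i * ?dk z (axis i 1))" if "z \<in> T" for z v
    proof -
      have "?dk z v = ?dk z (\<Sum>i\<in>UNIV. v $ i *s axis i 1)" by (simp add: basis_expansion)
      then show ?thesis unfolding linear_sum[OF lin[OF that]] holo_onD(2)[OF k that] .
    qed
    have ddk: "((\<lambda>z. ?dk z v) has_derivative frechet_derivative (\<lambda>z. ?dk z v) (at ?z)) (at ?z)" for v
      by (rule holo_onD(1)[OF cvec.holo_on_frechet_derivative[OF T(1) k] T(2)])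
    \<comment> \<open>Stated for arbitrary fields so that it serves both orders of
      composition.\<close>
    have main: "V p (\<lambda>q. W q h) = ?dk ?z (frechet_derivative b (at ?z) (a ?z))
        + (\<Sum>i\<in>UNIV. b ?z $ i * frechet_derivative (\<lambda>z. ?dk z (axis i 1)) (at ?z) (a ?z))"
      if V: "\<And>q. q \<in> dom_of c \<Longrightarrow> V q = tvec X A c q (a (coord c q))"
        and W: "\<And>q. q \<in> dom_of c \<Longrightarrow> W q = tvec X A c q (b (coord c q))"
        and b: "holo_on (*s) (*s) (img c) b" for V W a b
    proof -
      have Wk: "W (param c z) h = (\<Sum>i\<in>UNIV. b z $ i * ?dk z (axis i 1))" if z: "z \<in> T" for z
      proof -
        have zc: "z \<in> img c" using z T(3) by blast
        have "holo_near X A (param c z) h"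
          unfolding holo_near_iff[OF c param_in_dom[OF zc]] using T z zc by auto
        from tvec_apply[OF c param_in_dom[OF zc] this] show ?thesis
          using W[OF param_in_dom[OF zc]] sum[OF z, of "b z"] zc by (simp add: k_def)
      qed
      let ?D = "\<lambda>u. \<Sum>i\<in>UNIV. b ?z $ i * frechet_derivative (\<lambda>z. ?dk z (axis i 1)) (at ?z) u
          + frechet_derivative b (at ?z) u $ i * ?dk ?z (axis i 1)"
      have bi: "((\<lambda>z. b z $ i) has_derivative (\<lambda>u. frechet_derivative b (at z) u $ i)) (at z)" if "z \<in> T" for z i
        by (rule bounded_linear.has_derivative[OF bounded_linear_vec_nth holo_onD(1)[OF b]]) (use that T in auto)
      \<comment> \<open>Holomorphy of the function obtained from \<open>W\<close> must be
        established: by convention \<open>V p\<close> gives 0 on functions that are not holomorphic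
        near \<open>p\<close>.\<close>
      have "holo_on (*s) (*) T (\<lambda>z. \<Sum>i\<in>UNIV. b z $ i * ?dk z (axis i 1))"
        unfolding holo_on_def
      proof
        fix z assume z: "z \<in> T"
        have "((\<lambda>z. \<Sum>i\<in>UNIV. b z $ i * ?dk z (axis i 1)) has_derivative
          (\<lambda>u. \<Sum>i\<in>UNIV. b z $ i * frechet_derivative (\<lambda>z. ?dk z (axis i 1)) (at z) u
          + frechet_derivative b (at z) u $ i * ?dk z (axis i 1))) (at z)"
          by (intro has_derivative_sum has_derivative_mult bi z
              holo_onD(1)[OF cvec.holo_on_frechet_derivative[OF T(1) k]])
        moreover have zc: "z \<in> img c" using z T(3) by blast
        ultimately show "\<exists>D. ((\<lambda>z. \<Sum>i\<in>UNIV. b z $ i * ?dk z (axis i 1)) has_derivative D) (at z) \<and>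
            (\<forall>a v. D (a *s v) = a * D v)"
          by (intro exI conjI allI)
             (assumption, simp add: holo_onD(2)[OF b zc] holo_onD(2)[OF cvec.holo_on_frechet_derivative[OF T(1) k] z]
               sum_distrib_left algebra_simps)
      qed
      then have "holo_on (*s) (*) T (\<lambda>z. W (param c z) h)"
        by (rule holo_on_cong_open[OF T(1), rotated]) (rule Wk)
      then have near: "holo_near X A p (\<lambda>q. W q h)"
        unfolding holo_near_iff[OF c p] using T by blast
      have "((\<lambda>z. \<Sum>i\<in>UNIV. b z $ i * ?dk z (axis i 1)) has_derivative ?D) (at ?z)"
        by (intro has_derivative_sum has_derivative_mult ddk bi T)
      then have "((\<lambda>z. W (param c z) h) has_derivative ?D) (at ?z)"
        by (rule has_derivative_transform_within_open[OF _ T(1,2)]) (simp add: Wk)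
      from fun_cong[OF frechet_derivative_at[OF this, symmetric], of "a ?z"]
      have "V p (\<lambda>q. W q h) = ?D (a ?z)"
        unfolding V[OF p] tvec_apply[OF c p near] .
      also have "\<dots> = ?dk ?z (frechet_derivative b (at ?z) (a ?z))
        + (\<Sum>i\<in>UNIV. b ?z $ i * frechet_derivative (\<lambda>z. ?dk z (axis i 1)) (at ?z) (a ?z))"
        unfolding sum[OF T(2), of "frechet_derivative b (at ?z) (a ?z)"] by (simp add: sum.distrib)
      finally show ?thesis .
    qed
    have second: "(\<Sum>i\<in>UNIV. v $ i * frechet_derivative (\<lambda>z. ?dk z (axis i 1)) (at ?z) u) =
        frechet_derivative (\<lambda>z. ?dk z v) (at ?z) u" for u v
    proof -
      have "((\<lambda>z. \<Sum>i\<in>UNIV. v $ i * ?dk z (axis i 1)) has_derivative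
          (\<lambda>u. \<Sum>i\<in>UNIV. v $ i * frechet_derivative (\<lambda>z. ?dk z (axis i 1)) (at ?z) u)) (at ?z)"
        by (intro has_derivative_sum has_derivative_mult_right ddk)
      then have "((\<lambda>z. ?dk z v) has_derivative
          (\<lambda>u. \<Sum>i\<in>UNIV. v $ i * frechet_derivative (\<lambda>z. ?dk z (axis i 1)) (at ?z) u)) (at ?z)"
        by (rule has_derivative_transform_within_open[OF _ T(1,2)]) (rule sum[symmetric])
      from fun_cong[OF frechet_derivative_at[OF this], of u] show ?thesis .
    qed
    have "lie_bracket X A V W p h = ?dk ?z (frechet_derivative b (at ?z) (a ?z)) - ?dk ?z (frechet_derivative a (at ?z) (b ?z))"
      using h main[OF V W b] main[OF W V a] cvec.frechet_derivative_commute[OF T(1) k T(2), of "a ?z" "b ?z"]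
      by (simp add: lie_bracket_def second)
    then show ?thesis
      by (simp add: tvec_apply[OF c p h] linear_diff[OF lin[OF T(2)], symmetric] k_def[symmetric])
  qed
qed

end

section \<open>Left translations and the invariant frame\<close>

locale complex_lie = group G + complex_mfd X A
  for G :: "('a, 'b) monoid_scheme" (structure) and X and A :: "('a, 'n::finite) chart set" +
  assumes lie: "complex_lie_group G X A"
begin

lemma topspace_eq: "topspace X = carrier G"
  using lie by (simp add: complex_lie_group_def)

lemma dom_carrier: "c \<in> A \<Longrightarrow> p \<in> dom_of c \<Longrightarrow> p \<in> carrier G"
  using dom_subset topspace_eq by blast

lemma param_carrier: "c \<in> A \<Longrightarrow> z \<in> img c \<Longrightarrow> param c z \<in> carrier G"
  using dom_carrier param_in_dom by metis

section \<open>Holomorphy of multiplication and left translations\<close>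

lemma mult_holo:
  assumes c: "c \<in> A" and d: "d \<in> A" and e: "e \<in> A"
  shows "open {(y, z). y \<in> img c \<and> z \<in> img d \<and> param c y \<otimes> param d z \<in> dom_of e}"
    and "holo_on pair_scale (*s) {(y, z). y \<in> img c \<and> z \<in> img d \<and> param c y \<otimes> param d z \<in> dom_of e}
      (\<lambda>(y, z). coord e (param c y \<otimes> param d z))"
proof -
  have mult: "holomorphic_map2 X A (\<lambda>p q. p \<otimes> q)"
    using lie by (simp add: complex_lie_group_def)
  then show "holo_on pair_scale (*s) {(y, z). y \<in> img c \<and> z \<in> img d \<and> param c y \<otimes> param d z \<in> dom_of e}
      (\<lambda>(y, z). coord e (param c y \<otimes> param d z))"
    using c d e unfolding holomorphic_map2_def by blast
  let ?T = "prod_topology (top_of_set (img c)) (top_of_set (img d))"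
  have "continuous_map ?T (prod_topology X X) (\<lambda>(y, z). (param c y, param d z))"
    by (rule iffD2[OF continuous_map_prod_top]) (use continuous_map_param c d in blast)
  moreover have "continuous_map (prod_topology X X) X (\<lambda>(p, q). p \<otimes> q)"
    using mult unfolding holomorphic_map2_def by blast
  ultimately have "continuous_map ?T X ((\<lambda>(p, q). p \<otimes> q) \<circ> (\<lambda>(y, z). (param c y, param d z)))"
    by (rule continuous_map_compose)
  from openin_continuous_map_preimage[OF this openin_dom[OF e]]
  have "openin ?T {(y, z). y \<in> img c \<and> z \<in> img d \<and> param c y \<otimes> param d z \<in> dom_of e}"
    by (rule back_subst[of "openin ?T"]) auto
  moreover have "?T = top_of_set (img c \<times> img d)"
    by (simp add: prod_topology_subtopology subtopology_subtopology euclidean_product_topology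
        Times_Int_Times)
  ultimately show "open {(y, z). y \<in> img c \<and> z \<in> img d \<and> param c y \<otimes> param d z \<in> dom_of e}"
    using openin_open_trans[OF _ open_Times[OF open_img[OF c] open_img[OF d]]] by simp
qed

text \<open>Left translation is the multiplication restricted to the slice of first coordinate
  \<open>coord e g\<close>, in a chart \<open>e\<close> around \<open>g\<close>.\<close>

lemma translation_holo:
  assumes g: "g \<in> carrier G" and c: "c \<in> A" and d: "d \<in> A"
  shows "open {y \<in> img c. g \<otimes> param c y \<in> dom_of d}"
    and "holo_on (*s) (*s) {y \<in> img c. g \<otimes> param c y \<in> dom_of d} (\<lambda>y. coord d (g \<otimes> param c y))"
proof -
  obtain e where e: "e \<in> A" "g \<in> dom_of e" using ex_chart g topspace_eq by blast
  let ?S = "{y \<in> img c. g \<otimes> param c y \<in> dom_of d}"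
  let ?P = "{(y, z). y \<in> img e \<and> z \<in> img c \<and> param e y \<otimes> param c z \<in> dom_of d}"
  have S: "?S = Pair (coord e g) -` ?P" using e by auto
  show "open ?S"
    unfolding S by (intro open_vimage mult_holo(1)[OF e(1) c d] continuous_intros)
  have "holo_on (*s) pair_scale ?S (\<lambda>y. (coord e g, y))"
    unfolding holo_on_def
  proof (intro ballI exI conjI allI)
    fix x show "((\<lambda>y. (coord e g, y)) has_derivative (\<lambda>v. (0, v))) (at x)"
      by (auto intro!: derivative_eq_intros)
  qed (simp add: pair_scale_def)
  from holo_on_compose[OF this mult_holo(2)[OF e(1) c d]]
  show "holo_on (*s) (*s) ?S (\<lambda>y. coord d (g \<otimes> param c y))"
    using e by (auto simp: image_subset_iff)
qed

lemma holo_near_translate: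
  assumes g: "g \<in> carrier G" and p: "p \<in> carrier G" and h: "holo_near X A (g \<otimes> p) h"
  shows "holo_near X A p (h \<circ> (\<lambda>q. g \<otimes> q))"
proof -
  obtain c where c: "c \<in> A" "p \<in> dom_of c" using ex_chart p topspace_eq by blast
  obtain d where d: "d \<in> A" "g \<otimes> p \<in> dom_of d" using ex_chart p g topspace_eq m_closed by blast
  obtain T where T: "open T" "coord d (g \<otimes> p) \<in> T" "T \<subseteq> img d" "holo_on (*s) (*) T (\<lambda>z. h (param d z))"
    using h unfolding holo_near_iff[OF d] by blast
  let ?S = "{y \<in> img c. g \<otimes> param c y \<in> dom_of d}"
  let ?f = "\<lambda>y. coord d (g \<otimes> param c y)"
  note S = translation_holo[OF g c(1) d(1)]
  have o: "open (?S \<inter> ?f -` T)"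
    using continuous_open_preimage[OF holo_on_imp_continuous_on[OF S(2)] S(1) T(1)] .
  have "holo_on (*s) (*) (?S \<inter> ?f -` T) (\<lambda>y. h (param d (?f y)))"
    by (rule holo_on_compose[OF holo_on_subset[OF S(2)] T(4)]) auto
  then have "holo_on (*s) (*) (?S \<inter> ?f -` T) (\<lambda>y. (h \<circ> (\<lambda>q. g \<otimes> q)) (param c y))"
    by (rule holo_on_cong_open[OF o, rotated]) (use d in auto)
  then show ?thesis
    unfolding holo_near_iff[OF c] using o c d T(2) by (intro exI[of _ "?S \<inter> ?f -` T"]) auto
qed

lemma openin_carrier: "openin X (carrier G)"
  using openin_topspace[of X] by (simp add: topspace_eq)

text \<open>The equivalence ensures that a pushforward and the tangent vector at
  \<open>g \<otimes> p\<close> take the default value 0 on the same functions. The converse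
  translates back by \<open>inv g\<close>.\<close>

lemma holo_near_translate_iff:
  assumes g: "g \<in> carrier G" and p: "p \<in> carrier G"
  shows "holo_near X A p (h \<circ> (\<lambda>q. g \<otimes> q)) \<longleftrightarrow> holo_near X A (g \<otimes> p) h"
proof
  assume "holo_near X A p (h \<circ> (\<lambda>q. g \<otimes> q))"
  moreover have "p = inv g \<otimes> (g \<otimes> p)" using g p by (simp add: m_assoc[symmetric])
  ultimately have "holo_near X A (g \<otimes> p) ((h \<circ> (\<lambda>q. g \<otimes> q)) \<circ> (\<lambda>q. inv g \<otimes> q))"
    using holo_near_translate[of "inv g" "g \<otimes> p"] g p by simp
  then show "holo_near X A (g \<otimes> p) h"
    by (rule holo_near_cong[OF openin_carrier, rotated 2]) (use g p in \<open>auto simp: m_assoc[symmetric]\<close>)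
qed (rule holo_near_translate[OF g p])

lemma pushforward_tvec:
  assumes g: "g \<in> carrier G" and c: "c \<in> A" "p \<in> dom_of c" and d: "d \<in> A" "g \<otimes> p \<in> dom_of d"
  shows "pushforward (\<lambda>q. g \<otimes> q) (tvec X A c p w) =
    tvec X A d (g \<otimes> p) (frechet_derivative (\<lambda>y. coord d (g \<otimes> param c y)) (at (coord c p)) w)"
proof
  fix h
  let ?f = "\<lambda>y. coord d (g \<otimes> param c y)"
  let ?S = "{y \<in> img c. g \<otimes> param c y \<in> dom_of d}"
  have p: "p \<in> carrier G" using dom_carrier[OF c] .
  show "pushforward (\<lambda>q. g \<otimes> q) (tvec X A c p w) h =
    tvec X A d (g \<otimes> p) (frechet_derivative ?f (at (coord c p)) w) h"
  proof (cases "holo_near X A (g \<otimes> p) h")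
    case False
    then show ?thesis
      using holo_near_translate_iff[OF g p] by (simp add: pushforward_def tvec_not_holo)
  next
    case True
    note S = translation_holo[OF g c(1) d(1)]
    have pS: "coord c p \<in> ?S" using c d by auto
    have "((\<lambda>y. h (param d (?f y))) has_derivative
        (\<lambda>w. frechet_derivative (\<lambda>z. h (param d z)) (at (coord d (g \<otimes> p)))
          (frechet_derivative ?f (at (coord c p)) w))) (at (coord c p))"
      by (rule has_derivative_compose[OF holo_onD(1)[OF S(2) pS]])
         (use holo_near_derivative(1)[OF d True] c in simp)
    then have "((\<lambda>y. (h \<circ> (\<lambda>q. g \<otimes> q)) (param c y)) has_derivative
        (\<lambda>w. frechet_derivative (\<lambda>z. h (param d z)) (at (coord d (g \<otimes> p)))
          (frechet_derivative ?f (at (coord c p)) w))) (at (coord c p))"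
      by (rule has_derivative_transform_within_open[OF _ S(1) pS]) (use d in auto)
    from fun_cong[OF frechet_derivative_at[OF this], of w]
    show ?thesis
      unfolding pushforward_def tvec_apply[OF d True]
        tvec_apply[OF c holo_near_translate[OF g p True]] by (rule sym)
  qed
qed

section \<open>The left invariant frame\<close>

definition "c0 = (SOME c. c \<in> A \<and> \<one> \<in> dom_of c)"

lemma c0: "c0 \<in> A" "\<one> \<in> dom_of c0"
proof -
  have "\<exists>c. c \<in> A \<and> \<one> \<in> dom_of c" using ex_chart topspace_eq one_closed by blast
  from someI_ex[OF this] show "c0 \<in> A" "\<one> \<in> dom_of c0" unfolding c0_def by blast+
qed

text \<open>Coordinate form of the differential of left translation at the unit, with components in
  \<open>c0\<close> at the unit and in \<open>c\<close> at the image point.\<close>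

definition frame :: "('a, 'n) chart \<Rightarrow> complex^'n \<Rightarrow> complex^'n \<Rightarrow> complex^'n" where
  "frame c z v = frechet_derivative (\<lambda>y. coord c (param c z \<otimes> param c0 y)) (at (coord c0 \<one>)) v"

lemma pushforward_frame:
  assumes c: "c \<in> A" and p: "p \<in> dom_of c"
  shows "pushforward (\<lambda>q. p \<otimes> q) (tvec X A c0 \<one> v) = tvec X A c p (frame c (coord c p) v)"
  using pushforward_tvec[OF dom_carrier[OF c p] c0 c, of v] p c dom_carrier[OF c p]
  by (simp add: frame_def)

lemma frame_linear:
  assumes c: "c \<in> A" and z: "z \<in> img c"
  shows "frame c z (v + v') = frame c z v + frame c z v'" "frame c z (a *s v) = a *s frame c z v"
proof -
  note S = translation_holo[OF param_carrier[OF c z] c0(1) c]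
  have 1: "coord c0 \<one> \<in> {y \<in> img c0. param c z \<otimes> param c0 y \<in> dom_of c}"
    using c0 param_carrier[OF c z] z by simp
  show "frame c z (v + v') = frame c z v + frame c z v'"
    unfolding frame_def using has_derivative_linear[OF holo_onD(1)[OF S(2) 1]] by (rule linear_add)
  show "frame c z (a *s v) = a *s frame c z v"
    unfolding frame_def by (rule holo_onD(2)[OF S(2) 1])
qed

text \<open>Testing the pushed vector on functions composed with translation by the inverse recovers
  the vector at the unit.\<close>

lemma frame_inj:
  assumes c: "c \<in> A" and z: "z \<in> img c" and 0: "frame c z v = 0"
  shows "v = 0"
proof -
  let ?p = "param c z"
  have p: "?p \<in> carrier G" by (rule param_carrier[OF c z])
  have "pushforward (\<lambda>q. ?p \<otimes> q) (tvec X A c0 \<one> v) = (\<lambda>h. 0)"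
    using pushforward_frame[OF c param_in_dom[OF z], of v] z by (simp add: 0 tvec_0)
  then have "tvec X A c0 \<one> v (h \<circ> (\<lambda>q. inv ?p \<otimes> q) \<circ> (\<lambda>q. ?p \<otimes> q)) = 0" for h
    unfolding pushforward_def by (rule fun_cong)
  moreover have "tvec X A c0 \<one> v (h \<circ> (\<lambda>q. inv ?p \<otimes> q) \<circ> (\<lambda>q. ?p \<otimes> q)) = tvec X A c0 \<one> v h" for h
    by (rule tvec_local[OF c0 openin_carrier]) (use p in \<open>auto simp: m_assoc[symmetric]\<close>)
  ultimately have "tvec X A c0 \<one> v = tvec X A c0 \<one> 0"
    by (auto simp: tvec_0)
  then show ?thesis unfolding tvec_inject[OF c0] .
qed

text \<open>The frame is a partial derivative of the multiplication in its second argument, taken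
  along the slice where that argument is the unit; derivatives of jointly holomorphic maps are
  holomorphic.\<close>

lemma frame_holo:
  assumes c: "c \<in> A"
  shows "holo_on (*s) (*s) (img c) (\<lambda>z. frame c z v)"
proof -
  let ?P = "{(y, z). y \<in> img c \<and> z \<in> img c0 \<and> param c y \<otimes> param c0 z \<in> dom_of c}"
  let ?m = "\<lambda>(y, z). coord c (param c y \<otimes> param c0 z)"
  note P = mult_holo[OF c c0(1) c]
  have in_P: "(z, coord c0 \<one>) \<in> ?P" if "z \<in> img c" for z
    using that c0 param_carrier[OF c that] by simp
  have "holo_on (*s) pair_scale (img c) (\<lambda>z. (z, coord c0 \<one>))"
    unfolding holo_on_def
  proof (intro ballI exI conjI allI)
    fix x show "((\<lambda>z. (z, coord c0 \<one>)) has_derivative (\<lambda>v. (v, 0))) (at x)"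
      by (auto intro!: derivative_eq_intros)
  qed (simp add: pair_scale_def)
  then have "holo_on (*s) (*s) (img c) (\<lambda>z. frechet_derivative ?m (at (z, coord c0 \<one>)) (0, v))"
    by (rule holo_on_compose[OF _ cvec2.holo_on_frechet_derivative_vec[OF P, of "(0, v)"]])
       (intro image_subsetI in_P)
  then show ?thesis
  proof (rule holo_on_cong_open[OF open_img[OF c], rotated])
    fix z assume "z \<in> img c"
    from has_derivative_fiber[OF differentiableI[OF holo_onD(1)[OF P(2) in_P[OF this]]]]
    have "((\<lambda>y. coord c (param c z \<otimes> param c0 y)) has_derivative
        (\<lambda>v. frechet_derivative ?m (at (z, coord c0 \<one>)) (0, v))) (at (coord c0 \<one>))"
      by simp
    from fun_cong[OF frechet_derivative_at[OF this], of v]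
    show "frame c z v = frechet_derivative ?m (at (z, coord c0 \<one>)) (0, v)"
      by (simp add: frame_def)
  qed
qed

section \<open>The Lie algebra and its brackets\<close>

text \<open>The value off the carrier matches the convention in
  \<open>holomorphic_vector_field\<close>, so that equality of fields is equality of
  functions.\<close>

definition invariant_field :: "complex^'n \<Rightarrow> 'a \<Rightarrow> 'a tangent" where
  "invariant_field v p = (if p \<in> carrier G then pushforward (\<lambda>q. p \<otimes> q) (tvec X A c0 \<one> v) else (\<lambda>h. 0))"

lemma invariant_field_eq:
  "c \<in> A \<Longrightarrow> p \<in> dom_of c \<Longrightarrow> invariant_field v p = tvec X A c p (frame c (coord c p) v)"
  by (simp add: invariant_field_def dom_carrier pushforward_frame)

text \<open>Writing \<open>p = p \<otimes> \<one>\<close>, invariance determines a field by its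
  value at the unit; conversely, holomorphy of the frame makes each translated vector a holomorphic
  field.\<close>

lemma lie_algebra_eq: "lie_algebra G X A = range invariant_field"
proof
  show "lie_algebra G X A \<subseteq> range invariant_field"
  proof
    fix V assume V: "V \<in> lie_algebra G X A"
    then obtain w where "\<forall>p\<in>dom_of c0. V p = tvec X A c0 p (w (coord c0 p))"
      using c0 unfolding lie_algebra_def holomorphic_vector_field_def by blast
    then have one: "V \<one> = tvec X A c0 \<one> (w (coord c0 \<one>))" using c0 by blast
    have "V p = invariant_field (w (coord c0 \<one>)) p" for p
    proof (cases "p \<in> carrier G")
      case True
      then have "pushforward (\<lambda>q. p \<otimes> q) (V \<one>) = V (p \<otimes> \<one>)"
        using V unfolding lie_algebra_def by blast
      then show ?thesis using True by (simp add: invariant_field_def one)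
    next
      case False
      then show ?thesis
        using V by (auto simp: invariant_field_def lie_algebra_def holomorphic_vector_field_def topspace_eq)
    qed
    then show "V \<in> range invariant_field" by blast
  qed
  show "range invariant_field \<subseteq> lie_algebra G X A"
  proof clarify
    fix v
    have "holomorphic_vector_field X A (invariant_field v)"
      unfolding holomorphic_vector_field_def
    proof (intro conjI ballI allI impI)
      fix c assume "c \<in> A"
      then show "\<exists>w. holo_on (*s) (*s) (img c) w \<and>
          (\<forall>p\<in>dom_of c. invariant_field v p = tvec X A c p (w (coord c p)))"
        using frame_holo invariant_field_eq by (intro exI[of _ "\<lambda>z. frame c z v"]) blast
    qed (simp add: invariant_field_def topspace_eq)
    moreover have "pushforward (\<lambda>q. g \<otimes> q) (invariant_field v p) = invariant_field v (g \<otimes> p)"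
      if g: "g \<in> carrier G" and p: "p \<in> carrier G" for g p
    proof
      fix h
      have "tvec X A c0 \<one> v (h \<circ> (\<lambda>q. g \<otimes> q) \<circ> (\<lambda>q. p \<otimes> q)) = tvec X A c0 \<one> v (h \<circ> (\<lambda>q. g \<otimes> p \<otimes> q))"
        by (rule tvec_local[OF c0 openin_carrier]) (use g p in \<open>auto simp: m_assoc\<close>)
      then show "pushforward (\<lambda>q. g \<otimes> q) (invariant_field v p) h = invariant_field v (g \<otimes> p) h"
        using g p by (simp add: invariant_field_def pushforward_def)
    qed
    ultimately show "invariant_field v \<in> lie_algebra G X A"
      by (simp add: lie_algebra_def)
  qed
qed

lemma abelian_iff:
  "abelian_lie_algebra G X A \<longleftrightarrow> (\<forall>c\<in>A. \<forall>z\<in>img c. \<forall>v v'.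
    frechet_derivative (\<lambda>z. frame c z v') (at z) (frame c z v) =
    frechet_derivative (\<lambda>z. frame c z v) (at z) (frame c z v'))" (is "_ \<longleftrightarrow> ?sym")
proof -
  have bracket: "lie_bracket X A (invariant_field v) (invariant_field v') p = tvec X A c p
      (frechet_derivative (\<lambda>z. frame c z v') (at (coord c p)) (frame c (coord c p) v) -
       frechet_derivative (\<lambda>z. frame c z v) (at (coord c p)) (frame c (coord c p) v'))"
    if "c \<in> A" "p \<in> dom_of c" for c p v v'
    by (rule lie_bracket_tvec[OF that]) (use that frame_holo invariant_field_eq in auto)
  have abel: "abelian_lie_algebra G X A \<longleftrightarrow>
      (\<forall>v v' p. lie_bracket X A (invariant_field v) (invariant_field v') p = (\<lambda>h. 0))"
    unfolding abelian_lie_algebra_def lie_algebra_eq fun_eq_iff[of _ "\<lambda>p h. 0"] by blast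
  show ?thesis
  proof
    assume a: "abelian_lie_algebra G X A"
    show ?sym
    proof (intro ballI allI)
      fix c z v v' assume c: "c \<in> A" and z: "z \<in> img c"
      have "tvec X A c (param c z) (frechet_derivative (\<lambda>z. frame c z v') (at z) (frame c z v) -
          frechet_derivative (\<lambda>z. frame c z v) (at z) (frame c z v')) = tvec X A c (param c z) 0"
        using a bracket[OF c param_in_dom[OF z], of v v'] z unfolding abel tvec_0 by simp
      then show "frechet_derivative (\<lambda>z. frame c z v') (at z) (frame c z v) =
          frechet_derivative (\<lambda>z. frame c z v) (at z) (frame c z v')"
        unfolding tvec_inject[OF c param_in_dom[OF z]] by simp
    qed
  next
    assume sym: ?sym
    show "abelian_lie_algebra G X A"
      unfolding abel
    proof (intro allI)
      fix v v' p
      show "lie_bracket X A (invariant_field v) (invariant_field v') p = (\<lambda>h. 0)"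
      proof (cases "p \<in> topspace X")
        case True
        then obtain c where c: "c \<in> A" "p \<in> dom_of c" using ex_chart by blast
        then have "coord c p \<in> img c" by blast
        with sym c(1) have "frechet_derivative (\<lambda>z. frame c z v') (at (coord c p)) (frame c (coord c p) v) =
            frechet_derivative (\<lambda>z. frame c z v) (at (coord c p)) (frame c (coord c p) v')"
          by blast
        then show ?thesis unfolding bracket[OF c] by (simp add: tvec_0)
      next
        case False
        \<comment> \<open>Outside the space no open neighbourhood exists, so the guard in
          \<open>lie_bracket\<close> yields 0.\<close>
        then have "\<not> holo_near X A p h" for h
          unfolding holo_near_def using openin_subset by blast
        then show ?thesis by (simp add: lie_bracket_def)
      qed
    qed
  qed
qed

lemma frame_invariant_local_G:
  assumes F: "complex_finsler_metric X A F" and inv: "left_invariant_metric G X A F" and c: "c \<in> A"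
  shows "frame_invariant (img c) (local_G X A F c) (frame c)"
proof
  let ?r = "local_rep X A F c"
  let ?O = "img c \<times> (UNIV - {0 :: complex^'n})"
  have O: "open ?O" by (intro open_Times open_img c open_delete open_UNIV)
  \<comment> \<open>Two orders of differentiability of F off the zero section; the chain rule passes
    them on to its square.\<close>
  have "Ck_on (Suc (Suc 0)) ?O ?r"
    using F c unfolding complex_finsler_metric_def smooth_on_def by blast
  then have r: "?r differentiable (at u)" "(\<lambda>u. frechet_derivative ?r (at u) b) differentiable (at u)"
    if "u \<in> ?O" for u b
    using that unfolding Ck_on.simps by blast+
  have g: "(local_G X A F c has_derivative (\<lambda>b. of_real (2 * ?r u * frechet_derivative ?r (at u) b))) (at u)"
    if "u \<in> ?O" for u
  proof -
    have "(?r has_derivative frechet_derivative ?r (at u)) (at u)"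
      using r(1)[OF that] frechet_derivative_works by blast
    from has_derivative_of_real[OF has_derivative_power[OF this, of 2]]
    show ?thesis unfolding local_G_def by (simp add: mult_ac)
  qed
  show "open (img c)" by (rule open_img[OF c])
  show "cnj (local_G X A F c u) = local_G X A F c u" for u
    by (simp add: local_G_def)
  show "local_G X A F c differentiable (at u)" if "u \<in> ?O" for u
    using g[OF that] by (rule differentiableI)
  show "(\<lambda>u. frechet_derivative (local_G X A F c) (at u) b) differentiable (at u)" if u: "u \<in> ?O" for u b
  proof (rule differentiable_cong_open[OF O u])
    show "frechet_derivative (local_G X A F c) (at u) b = of_real (2 * ?r u * frechet_derivative ?r (at u) b)"
      if "u \<in> ?O" for u
      using fun_cong[OF frechet_derivative_at[OF g[OF that]]] by simp
    have "(\<lambda>u. 2 * ?r u * frechet_derivative ?r (at u) b) differentiable (at u)"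
      by (intro differentiable_mult differentiable_const r u)
    then show "(\<lambda>u. complex_of_real (2 * ?r u * frechet_derivative ?r (at u) b)) differentiable (at u)"
      unfolding differentiable_def using has_derivative_of_real by blast
  qed
  show "hermitian_pos_def (hessian (local_G X A F c) u)" if "u \<in> ?O" for u
    using F c that unfolding complex_finsler_metric_def by blast
  show "holo_on (*s) (*s) (img c) (\<lambda>z. frame c z v)" for v
    by (rule frame_holo[OF c])
  show "frame c z (v + v') = frame c z v + frame c z v'" "frame c z (a *s v) = a *s frame c z v"
    if "z \<in> img c" for z a v v'
    using frame_linear[OF c that] by auto
  show "v = 0" if "z \<in> img c" "frame c z v = 0" for z v
    using frame_inj[OF c] that by blast
  \<comment> \<open>Translation by \<open>param c z\<close> carries the vector \<open>v\<close> at
    the unit to the frame vector over \<open>z\<close>, so invariance gives a value independent of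
    \<open>z\<close>.\<close>
  have "?r (z, frame c z v) = F (\<one>, tvec X A c0 \<one> v)" if z: "z \<in> img c" for z v
  proof -
    have "tvec X A c0 \<one> v \<in> tangent_space X A \<one>"
      unfolding tangent_space_def using c0 by blast
    then have "(\<one>, tvec X A c0 \<one> v) \<in> tangent_bundle X A"
      by (simp add: tangent_bundle_def topspace_eq)
    then have "F (param c z \<otimes> \<one>, pushforward (\<lambda>q. param c z \<otimes> q) (tvec X A c0 \<one> v)) = F (\<one>, tvec X A c0 \<one> v)"
      using inv param_carrier[OF c z] unfolding left_invariant_metric_def by blast
    then show ?thesis
      using param_carrier[OF c z] z
      by (simp add: pushforward_frame[OF c param_in_dom[OF z]] local_rep_def)
  qed
  then show "local_G X A F c (z, frame c z v) = local_G X A F c (z', frame c z' v)"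
    if "z \<in> img c" "z' \<in> img c" for z z' v
    using that by (simp add: local_G_def)
qed

end

theorem theorem1p3:
  fixes G :: "('a, 'b) monoid_scheme"
    and X :: "'a topology"
    and A :: "('a, 'n::finite) chart set"
    and F :: "'a \<times> 'a tangent \<Rightarrow> real"
  assumes "complex_lie_group G X A"
    and "complex_finsler_metric X A F"
    and "left_invariant_metric G X A F"
  shows "(strongly_kaehler X A F \<longleftrightarrow> kaehler X A F) \<and>
         (kaehler X A F \<longleftrightarrow> weakly_kaehler X A F) \<and>
         (kaehler X A F \<longleftrightarrow> abelian_lie_algebra G X A)"
proof -
  interpret complex_lie G X A
    using assms(1) unfolding complex_lie_group_def
    by (intro complex_lie.intro complex_mfd.intro complex_lie_axioms.intro assms(1)) auto
  \<comment> \<open>All these conditions quantify over the same charts and base points, so the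
    pointwise equivalences can be inserted under the quantifiers.\<close>
  have "strongly_kaehler X A F \<longleftrightarrow> abelian_lie_algebra G X A"
    "kaehler X A F \<longleftrightarrow> abelian_lie_algebra G X A"
    "weakly_kaehler X A F \<longleftrightarrow> abelian_lie_algebra G X A"
    unfolding strongly_kaehler_def kaehler_def weakly_kaehler_def abelian_iff
    using frame_invariant.kaehler_conditions[OF frame_invariant_local_G[OF assms(2,3)]]
    by (simp_all add: frame_invariant.DE_def[OF frame_invariant_local_G[OF assms(2,3)]] cong: ball_cong)
  then show ?thesis by blast
qed

end
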